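(* Let $\Omega\subset\mathbb{R}^n$ be a bounded open set with smooth boundary, $\mu>0$, $2\mu+n\lambda\ge0$, $\kappa>0$, $\gamma>1$, $R>0$, $\rho_0\in C(\bar\Omega)$ with $\rho_0>0$ in $\Omega$, $\rho_0=0$ on $\partial\Omega$, and $u_0,e_0$ continuous with $e_0\ge0$, $e_0\not\equiv0$ in $\Omega$. Then for every $T>0$ the problem (summation over repeated indices) $$\rho_0\partial_tv^i+(\gamma-1)b_i^j\partial_j(J^{-1}\rho_0\mathfrak e)=\mu b_l^k\partial_k(J^{-1}b_l^j\partial_jv^i)+(\mu+\lambda)b_i^k\partial_k(J^{-1}b_l^j\partial_jv^l),$$ $$\rho_0\partial_t\mathfrak e+(\gamma-1)J^{-1}\rho_0\mathfrak e\, b_i^j\partial_jv^i=\tfrac{\mu}{2}J^{-1}|b_l^j\partial_jv^i+(b_l^j\partial_jv^i)^*|^2+\lambda J^{-1}(b_i^j\partial_jv^i)^2+\tfrac{\kappa(\gamma-1)}{R}b_l^k\partial_k(J^{-1}b_l^j\partial_j\mathfrak e)$$ in $\Omega\times(0,T]$, together with $\eta_t=v$, $(v,\mathfrak e,\eta)=(u_0,e_0,x)$ on $\Omega\times\{t=0\}$, and $\mathfrak e=\partial_{x_i}\mathfrak e=0$ on $\partial\Omega\times(0,T]$, has no solution $(v,\mathfrak e,\eta)$ in $C^{2,1}(\bar\Omega\times[0,T])$.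
   Context: Here $\eta:\Omega\times[0,T]\to\mathbb{R}^n$ is the flow map, $J=\det D\eta$, $B=(D\eta)^{-1}$ with entries $B_i^j$, and $b=JB$ (transpose of the cofactor matrix of $D\eta$) with entries $b_i^j$; $(\cdot)^*$ denotes the transposed matrix; $|\cdot|$ of a matrix is the Frobenius norm. $C^{2,1}$ means $C^2$ in $x$ and $C^1$ in $t$. *)

theory Defs
  imports "HOL-Analysis.Analysis"
begin

definition dpart :: "'n::finite \<Rightarrow> (real^'n \<Rightarrow> real) \<Rightarrow> real^'n \<Rightarrow> real" where
  "dpart j f x = deriv (\<lambda>s. f (x + s *\<^sub>R axis j 1)) 0"

fun ipd :: "'n::finite list \<Rightarrow> (real^'n \<Rightarrow> real) \<Rightarrow> real^'n \<Rightarrow> real" where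
  "ipd [] f = f"
| "ipd (j # js) f = dpart j (ipd js f)"

definition smooth_fun_on :: "(real^'n::finite) set \<Rightarrow> (real^'n \<Rightarrow> real) \<Rightarrow> bool" where
  "smooth_fun_on U f \<longleftrightarrow>
     (\<forall>js. continuous_on U (ipd js f) \<and>
           (\<forall>x\<in>U. \<forall>j. (\<lambda>s. ipd js f (x + s *\<^sub>R axis j 1)) differentiable (at 0)))"

definition smooth_boundary :: "(real^'n::finite) set \<Rightarrow> bool" where
  "smooth_boundary \<Omega> \<longleftrightarrow>
     (\<forall>p\<in>frontier \<Omega>. \<exists>r>0. \<exists>\<phi>. smooth_fun_on (ball p r) \<phi> \<and>
        (\<forall>x\<in>ball p r. \<exists>j. dpart j \<phi> x \<noteq> 0) \<and>
        \<Omega> \<inter> ball p r = {x\<in>ball p r. \<phi> x < 0})"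

definition pdx :: "'n::finite \<Rightarrow> (real^'n \<Rightarrow> real \<Rightarrow> real) \<Rightarrow> real^'n \<Rightarrow> real \<Rightarrow> real" where
  "pdx j F x t = deriv (\<lambda>s. F (x + s *\<^sub>R axis j 1) t) 0"

definition pdt :: "real \<Rightarrow> (real^'n::finite \<Rightarrow> real \<Rightarrow> real) \<Rightarrow> real^'n \<Rightarrow> real \<Rightarrow> real" where
  "pdt T F x t = vector_derivative (\<lambda>s. F x s) (at t within {0..T})"

definition cont_ext :: "(real^'n::finite) set \<Rightarrow> real \<Rightarrow> (real^'n \<Rightarrow> real \<Rightarrow> real) \<Rightarrow> bool" where
  "cont_ext \<Omega> T G \<longleftrightarrow>
     (\<exists>H. continuous_on (closure \<Omega> \<times> {0..T}) H \<and> (\<forall>x\<in>\<Omega>. \<forall>t\<in>{0..T}. H (x, t) = G x t))"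

definition C21 :: "(real^'n::finite) set \<Rightarrow> real \<Rightarrow> (real^'n \<Rightarrow> real \<Rightarrow> real) \<Rightarrow> bool" where
  "C21 \<Omega> T F \<longleftrightarrow>
     continuous_on (closure \<Omega> \<times> {0..T}) (\<lambda>(x, t). F x t) \<and>
     (\<forall>t\<in>{0..T}. \<forall>x\<in>\<Omega>. \<forall>j.
        (\<lambda>s. F (x + s *\<^sub>R axis j 1) t) differentiable (at 0) \<and>
        (\<forall>k. (\<lambda>s. pdx j F (x + s *\<^sub>R axis k 1) t) differentiable (at 0))) \<and>
     (\<forall>x\<in>\<Omega>. \<forall>t\<in>{0..T}. (\<lambda>s. F x s) differentiable (at t within {0..T})) \<and>
     (\<forall>j. cont_ext \<Omega> T (pdx j F)) \<and>
     (\<forall>j k. cont_ext \<Omega> T (pdx k (pdx j F))) \<and>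
     cont_ext \<Omega> T (pdt T F)"

definition comp :: "(real^'n \<Rightarrow> real \<Rightarrow> real^'n) \<Rightarrow> 'n::finite \<Rightarrow> real^'n \<Rightarrow> real \<Rightarrow> real" where
  "comp w i = (\<lambda>y s. w y s $ i)"

definition Deta :: "(real^'n \<Rightarrow> real \<Rightarrow> real^'n) \<Rightarrow> real^'n \<Rightarrow> real \<Rightarrow> real^'n^'n::finite" where
  "Deta \<eta> x t = (\<chi> i j. pdx j (comp \<eta> i) x t)"

definition Jac :: "(real^'n \<Rightarrow> real \<Rightarrow> real^'n) \<Rightarrow> real^'n \<Rightarrow> real \<Rightarrow> real" where
  "Jac \<eta> x t = det (Deta \<eta> x t)"

text \<open>B = (D\<eta>)^{-1}, B_i^j = \<partial>x_j/\<partial>y_i = (D\<eta>)^{-1}\$j\$i; b = J B.\<close>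
definition Bm :: "(real^'n \<Rightarrow> real \<Rightarrow> real^'n) \<Rightarrow> 'n::finite \<Rightarrow> 'n \<Rightarrow> real^'n \<Rightarrow> real \<Rightarrow> real" where
  "Bm \<eta> i j x t = matrix_inv (Deta \<eta> x t) $ j $ i"

definition bm :: "(real^'n \<Rightarrow> real \<Rightarrow> real^'n) \<Rightarrow> 'n::finite \<Rightarrow> 'n \<Rightarrow> real^'n \<Rightarrow> real \<Rightarrow> real" where
  "bm \<eta> i j x t = Jac \<eta> x t * Bm \<eta> i j x t"

definition momentum_eq where
  "momentum_eq \<mu> lam \<gamma> T \<rho>0 v e \<eta> x t \<longleftrightarrow>
    (\<forall>i. \<rho>0 x * pdt T (comp v i) x t
       + (\<gamma> - 1) * (\<Sum>j\<in>UNIV. bm \<eta> i j x t *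
            pdx j (\<lambda>y s. inverse (Jac \<eta> y s) * \<rho>0 y * e y s) x t)
     = \<mu> * (\<Sum>l\<in>UNIV. \<Sum>k\<in>UNIV. bm \<eta> l k x t *
            pdx k (\<lambda>y s. inverse (Jac \<eta> y s) *
                (\<Sum>j\<in>UNIV. bm \<eta> l j y s * pdx j (comp v i) y s)) x t)
       + (\<mu> + lam) * (\<Sum>k\<in>UNIV. bm \<eta> i k x t *
            pdx k (\<lambda>y s. inverse (Jac \<eta> y s) *
                (\<Sum>l\<in>UNIV. \<Sum>j\<in>UNIV. bm \<eta> l j y s * pdx j (comp v l) y s)) x t))"

definition Mvel where
  "Mvel v \<eta> i l x t = (\<Sum>j\<in>UNIV. bm \<eta> l j x t * pdx j (comp v i) x t)"

definition energy_eq where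
  "energy_eq \<mu> lam \<kappa> \<gamma> R T \<rho>0 v e \<eta> x t \<longleftrightarrow>
    \<rho>0 x * pdt T e x t
      + (\<gamma> - 1) * inverse (Jac \<eta> x t) * \<rho>0 x * e x t *
          (\<Sum>i\<in>UNIV. \<Sum>j\<in>UNIV. bm \<eta> i j x t * pdx j (comp v i) x t)
    = \<mu> / 2 * inverse (Jac \<eta> x t) *
          (\<Sum>i\<in>UNIV. \<Sum>l\<in>UNIV. (Mvel v \<eta> i l x t + Mvel v \<eta> l i x t)^2)
      + lam * inverse (Jac \<eta> x t) *
          (\<Sum>i\<in>UNIV. \<Sum>j\<in>UNIV. bm \<eta> i j x t * pdx j (comp v i) x t)^2
      + \<kappa> * (\<gamma> - 1) / R * (\<Sum>l\<in>UNIV. \<Sum>k\<in>UNIV. bm \<eta> l k x t *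
            pdx k (\<lambda>y s. inverse (Jac \<eta> y s) *
               (\<Sum>j\<in>UNIV. bm \<eta> l j y s * pdx j e y s)) x t)"

definition is_solution where
  "is_solution \<Omega> \<mu> lam \<kappa> \<gamma> R T \<rho>0 u0 e0 v e \<eta> \<longleftrightarrow>
    (\<forall>i. C21 \<Omega> T (comp v i)) \<and> C21 \<Omega> T e \<and> (\<forall>i. C21 \<Omega> T (comp \<eta> i)) \<and>
    (\<forall>x\<in>\<Omega>. \<forall>t\<in>{0<..T}. Jac \<eta> x t \<noteq> 0) \<and>
    (\<forall>x\<in>\<Omega>. \<forall>t\<in>{0<..T}. momentum_eq \<mu> lam \<gamma> T \<rho>0 v e \<eta> x t) \<and>
    (\<forall>x\<in>\<Omega>. \<forall>t\<in>{0<..T}. energy_eq \<mu> lam \<kappa> \<gamma> R T \<rho>0 v e \<eta> x t) \<and>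
    (\<forall>x\<in>\<Omega>. \<forall>t\<in>{0<..T}. \<forall>i. pdt T (comp \<eta> i) x t = v x t $ i) \<and>
    (\<forall>x\<in>\<Omega>. v x 0 = u0 x \<and> e x 0 = e0 x \<and> \<eta> x 0 = x) \<and>
    (\<forall>x\<in>frontier \<Omega>. \<forall>t\<in>{0<..T}. e x t = 0 \<and>
        (\<forall>i. ((\<lambda>(y, s). pdx i e y s) \<longlongrightarrow> 0) (at (x, t) within \<Omega> \<times> {0..T})))"

end

theory Submission
  imports Defs
begin

text \<open>
  Near \<open>t = 0\<close> the matrix \<open>D\<eta>\<close> is close to the identity, so after expanding the
  divergence term the energy equation says that \<open>e\<close> is a supersolution of a uniformly elliptic,
  parabolic inequality \<open>\<rho>0 (e\<^sub>t + c e) \<ge> A : D\<^sup>2 e + \<beta> \<cdot> \<nabla>e\<close> with bounded coefficients: the viscous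
  dissipation is nonnegative because \<open>2\<mu> + n\<lambda> \<ge> 0\<close>. The vacuum at the boundary is
  harmless, since \<open>\<rho>0\<close> is bounded and only multiplies \<open>e\<^sub>t + c e\<close>. The weak maximum principle
  gives \<open>e \<ge> 0\<close>. Let \<open>x0\<close> be a point where \<open>e\<close> is initially positive, let \<open>p\<close> be a point of
  the boundary nearest to \<open>x0\<close>, and compare \<open>e\<close> with the barrier
  \<open>\<epsilon> (exp (-K |x - x0|\<^sup>2) - exp (-K r(t)\<^sup>2))\<close>, where the radius \<open>r(t)\<close> grows linearly from a small
  value to \<open>|p - x0|\<close> within a short time. As in the Hopf lemma, the inner normal derivative of
  \<open>e\<close> at \<open>p\<close> would then be positive at that time, against \<open>\<nabla>e = 0\<close>.
\<close>

section \<open>Continuous partial derivatives\<close>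

text \<open>The coordinates of the increment are switched on one at a time; on each axis-parallel
  segment the mean value theorem gives a partial derivative at a point near \<open>x\<close>, and
  continuity replaces it by the value at \<open>x\<close>. Total differentiability is what later
  permits differentiation along arbitrary directions.\<close>

lemma has_derivative_continuous_partials:
  fixes f :: "real^'n::finite \<Rightarrow> real"
  assumes U: "open U" "x \<in> U"
    and D: "\<And>y j. y \<in> U \<Longrightarrow> ((\<lambda>s. f (y + s *\<^sub>R axis j 1)) has_real_derivative g j y) (at 0)"
    and cont: "\<And>j. continuous_on U (g j)"
  shows "(f has_derivative (\<lambda>h. \<Sum>j\<in>UNIV. h $ j * g j x)) (at x)"
proof -
  \<comment> \<open>\<open>P S h\<close> keeps the coordinates in \<open>S\<close> and zeroes the
    others, so the induction over \<open>S\<close> ends with the full increment at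
    \<open>S = UNIV\<close>. The intermediate offsets are componentwise dominated by
    \<open>h\<close>, hence stay in the same ball.\<close>
  define P where "P S h = (\<chi> i. if i \<in> S then h $ i else 0)" for S and h :: "real^'n"
  have nP: "norm (P S h + s *\<^sub>R axis a 1) \<le> norm h" if "a \<notin> S" "\<bar>s\<bar> \<le> \<bar>h $ a\<bar>" for S h s a
    by (rule norm_le_componentwise_cart) (use that in \<open>auto simp: P_def axis_def\<close>)
  obtain r where r: "r > 0" "ball x r \<subseteq> U"
    using U open_contains_ball by blast
  have step: "\<forall>\<epsilon>>0. \<exists>\<delta>>0. \<forall>h. norm h < \<delta> \<longrightarrow>
      \<bar>f (x + P S h) - f x - (\<Sum>j\<in>S. h $ j * g j x)\<bar> \<le> \<epsilon> * norm h" for S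
    using finite[of S]
  proof (induction S rule: finite_induct)
    case empty
    have "P {} h = 0" for h by (simp add: P_def vec_eq_iff)
    then show ?case by (auto intro!: exI[of _ 1])
  next
    case (insert a S)
    show ?case
    proof (intro allI impI)
      fix \<epsilon> :: real assume "\<epsilon> > 0"
      then have e2: "\<epsilon> / 2 > 0" by simp
      then obtain \<delta>1 where d1: "\<delta>1 > 0" "\<And>h. norm h < \<delta>1 \<Longrightarrow>
          \<bar>f (x + P S h) - f x - (\<Sum>j\<in>S. h $ j * g j x)\<bar> \<le> \<epsilon> / 2 * norm h"
        using insert.IH by meson
      have "isCont (g a) x"
        using cont U continuous_on_eq_continuous_at by blast
      then obtain \<delta>2 where d2: "\<delta>2 > 0" "\<And>y. dist y x < \<delta>2 \<Longrightarrow> \<bar>g a y - g a x\<bar> < \<epsilon> / 2"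
        using e2 unfolding continuous_at dist_real_def[symmetric]
        by (metis LIM_def dist_self)
      show "\<exists>\<delta>>0. \<forall>h. norm h < \<delta> \<longrightarrow>
          \<bar>f (x + P (insert a S) h) - f x - (\<Sum>j\<in>insert a S. h $ j * g j x)\<bar> \<le> \<epsilon> * norm h"
      proof (intro exI[of _ "min r (min \<delta>1 \<delta>2)"] conjI allI impI)
        show "min r (min \<delta>1 \<delta>2) > 0" using r d1 d2 by simp
        fix h :: "real^'n" assume h: "norm h < min r (min \<delta>1 \<delta>2)"
        define y where "y s = x + P S h + s *\<^sub>R axis a 1" for s
        have Peq: "x + P (insert a S) h = y (h $ a)"
          using insert.hyps by (simp add: y_def P_def axis_def vec_eq_iff)
        have near: "dist (y s) x \<le> norm h" if "\<bar>s\<bar> \<le> \<bar>h $ a\<bar>" for s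
          using nP[OF insert.hyps(2) that] by (simp add: y_def dist_norm add.assoc)
        have yU: "y s \<in> U" if "\<bar>s\<bar> \<le> \<bar>h $ a\<bar>" for s
          using near[OF that] h r by (auto simp: dist_commute)
        have yd: "((\<lambda>s. f (y s)) has_real_derivative g a (y s)) (at s)" if "\<bar>s\<bar> \<le> \<bar>h $ a\<bar>" for s
        proof -
          have "((\<lambda>u. f (y s + u *\<^sub>R axis a 1)) has_real_derivative g a (y s)) (at 0)"
            using D[OF yU[OF that]] .
          then have "((\<lambda>u. f (y (s + u))) has_real_derivative g a (y s)) (at 0)"
            by (simp add: y_def scaleR_add_left add.assoc)
          then show ?thesis
            using DERIV_shift[of "\<lambda>u. f (y u)" "g a (y s)" 0 s] by (simp add: add.commute)
        qed
        have "\<exists>s. \<bar>s\<bar> \<le> \<bar>h $ a\<bar> \<and> f (y (h $ a)) - f (y 0) = h $ a * g a (y s)"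
        proof -
          consider "h $ a = 0" | "h $ a > 0" | "h $ a < 0" by linarith
          then show ?thesis
          proof cases
            case 1 then show ?thesis by auto
          next
            case 2
            then obtain z where "z > 0" "z < h $ a" "f (y (h $ a)) - f (y 0) = (h $ a - 0) * g a (y z)"
              using MVT2[of 0 "h $ a" "\<lambda>s. f (y s)" "\<lambda>s. g a (y s)"] yd by auto
            then show ?thesis by (intro exI[of _ z]) auto
          next
            case 3
            then obtain z where "z < 0" "z > h $ a" "f (y 0) - f (y (h $ a)) = (0 - h $ a) * g a (y z)"
              using MVT2[of "h $ a" 0 "\<lambda>s. f (y s)" "\<lambda>s. g a (y s)"] yd by auto
            then show ?thesis by (intro exI[of _ z]) (auto simp: algebra_simps)
          qed
        qed
        then obtain s where s: "\<bar>s\<bar> \<le> \<bar>h $ a\<bar>" "f (y (h $ a)) - f (y 0) = h $ a * g a (y s)" by blast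
        have "\<bar>h $ a * (g a (y s) - g a x)\<bar> \<le> norm h * (\<epsilon> / 2)"
          unfolding abs_mult
          using component_le_norm_cart[of h a] d2(2)[of "y s"] near[OF s(1)] h
          by (intro mult_mono) auto
        moreover have "\<bar>f (y 0) - f x - (\<Sum>j\<in>S. h $ j * g j x)\<bar> \<le> \<epsilon> / 2 * norm h"
          using d1(2)[of h] h by (simp add: y_def)
        moreover have "f (y (h $ a)) - f x - (\<Sum>j\<in>insert a S. h $ j * g j x) =
           (f (y 0) - f x - (\<Sum>j\<in>S. h $ j * g j x)) + h $ a * (g a (y s) - g a x)"
          using s(2) insert.hyps by (simp add: algebra_simps)
        ultimately show "\<bar>f (x + P (insert a S) h) - f x - (\<Sum>j\<in>insert a S. h $ j * g j x)\<bar> \<le> \<epsilon> * norm h"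
          unfolding Peq by (smt (verit, del_insts) mult.commute field_sum_of_halves distrib_left)
      qed
    qed
  qed
  have PU: "P UNIV h = h" for h by (simp add: P_def)
  have bl: "bounded_linear (\<lambda>h::real^'n. \<Sum>j\<in>UNIV. h $ j * g j x)"
    by (intro bounded_linear_sum bounded_linear_mult_const bounded_linear_vec_nth)
  show ?thesis
    unfolding has_derivative_at_alt
  proof (intro conjI allI impI bl)
    fix \<epsilon> :: real assume "\<epsilon> > 0"
    then obtain \<delta> where "\<delta> > 0" and dd: "\<And>h. norm h < \<delta> \<Longrightarrow>
      \<bar>f (x + P UNIV h) - f x - (\<Sum>j\<in>UNIV. h $ j * g j x)\<bar> \<le> \<epsilon> * norm h"
      using step[of UNIV] by meson
    then show "\<exists>d>0. \<forall>y. norm (y - x) < d \<longrightarrow>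
        norm (f y - f x - (\<Sum>j\<in>UNIV. (y - x) $ j * g j x)) \<le> \<epsilon> * norm (y - x)"
      by (intro exI[of _ \<delta>]) (use dd PU in \<open>auto dest: dd[of "_ - x"] simp del: vector_minus_component\<close>)
  qed
qed

lemma line_derivative_continuous_partials:
  fixes f :: "real^'n::finite \<Rightarrow> real"
  assumes U: "open U" "x + s *\<^sub>R \<xi> \<in> U"
    and D: "\<And>y j. y \<in> U \<Longrightarrow> ((\<lambda>s. f (y + s *\<^sub>R axis j 1)) has_real_derivative g j y) (at 0)"
    and cont: "\<And>j. continuous_on U (g j)"
  shows "((\<lambda>s. f (x + s *\<^sub>R \<xi>)) has_real_derivative (\<Sum>j\<in>UNIV. \<xi> $ j * g j (x + s *\<^sub>R \<xi>))) (at s)"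
proof -
  have "((\<lambda>s. x + s *\<^sub>R \<xi>) has_derivative (\<lambda>h. h *\<^sub>R \<xi>)) (at s)"
    by (auto intro!: derivative_eq_intros)
  from has_derivative_compose[OF this has_derivative_continuous_partials[OF U D cont]]
  have "((\<lambda>s. f (x + s *\<^sub>R \<xi>)) has_derivative (\<lambda>h. \<Sum>j\<in>UNIV. (h *\<^sub>R \<xi>) $ j * g j (x + s *\<^sub>R \<xi>))) (at s)" .
  then show ?thesis
    unfolding has_field_derivative_def
    by (rule has_derivative_eq_rhs) (auto simp: sum_distrib_left sum_distrib_right fun_eq_iff algebra_simps)
qed

text \<open>If \<open>c\<close> were negative, \<open>f'\<close> would vanish at 0 and be negative
  just to its right, and the mean value theorem would push \<open>f\<close> below
  \<open>f 0\<close>. Only a second derivative at the single point 0 enters, which suits functions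
  that are merely twice differentiable.\<close>

lemma second_derivative_local_min:
  fixes f f' :: "real \<Rightarrow> real"
  assumes r: "r > 0"
    and D: "\<And>s. \<bar>s\<bar> < r \<Longrightarrow> (f has_real_derivative f' s) (at s)"
    and D2: "(f' has_real_derivative c) (at 0)"
    and min: "\<And>s. \<bar>s\<bar> < r \<Longrightarrow> f 0 \<le> f s"
  shows "f' 0 = 0" "c \<ge> 0"
proof -
  show 0: "f' 0 = 0"
    using DERIV_local_min[of f "f' 0" 0 r] D[of 0] r min by auto
  show "c \<ge> 0"
  proof (rule ccontr)
    assume "\<not> c \<ge> 0"
    then obtain d where d: "d > 0" "\<And>h. 0 < h \<Longrightarrow> h < d \<Longrightarrow> f' h < 0"
      using DERIV_neg_dec_right[OF D2] 0 by auto
    define h where "h = min r d / 2"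
    have h: "0 < h" "h < r" "h < d" using r d by (auto simp: h_def min_def)
    obtain z where "0 < z" "z < h" "f h - f 0 = (h - 0) * f' z"
      using MVT2[of 0 h f f'] D h by auto
    then have "f h < f 0"
      using d(2)[of z] h mult_pos_neg[of h "f' z"] by simp
    then show False using min[of h] h by auto
  qed
qed

section \<open>Weak maximum principle\<close>

text \<open>The second derivative of \<open>F\<close> along the line through \<open>x\<close> in
  direction \<xi>. The mixed partials stand in the order in which termwise differentiation of the
  first derivative produces them, so no symmetry is invoked.\<close>

definition hess :: "(real^'n::finite \<Rightarrow> real \<Rightarrow> real) \<Rightarrow> real^'n \<Rightarrow> real \<Rightarrow> real^'n \<Rightarrow> real" where
  "hess F x t \<xi> = (\<Sum>j\<in>UNIV. \<Sum>k\<in>UNIV. \<xi> $ j * \<xi> $ k * pdx k (pdx j F) x t)"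

text \<open>The second-order part is \<open>\<Sum>\<^sub>l \<xi>\<^sub>l\<xi>\<^sub>l\<^sup>T : D\<^sup>2e\<close>: writing the coefficient matrix as a sum of rank-one
  matrices lets the second-derivative test be applied along each \<open>\<xi>\<^sub>l\<close> separately.\<close>
definition ell_coeffs :: "real \<Rightarrow> real \<Rightarrow> real \<Rightarrow> real^'n::finite \<Rightarrow> ('n \<Rightarrow> real^'n) \<Rightarrow> bool" where
  "ell_coeffs C \<theta> c \<beta> \<xi> \<longleftrightarrow> \<bar>c\<bar> \<le> C \<and> norm \<beta> \<le> C \<and> (\<forall>l. norm (\<xi> l) \<le> C) \<and>
     (\<forall>y. \<theta> * (norm y)\<^sup>2 \<le> (\<Sum>l\<in>UNIV. (y \<bullet> \<xi> l)\<^sup>2))"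

text \<open>The coefficients are chosen afresh at every point and only their bounds \<open>C\<close>
  and \<theta> are uniform: the comparison argument looks at a single touching point.\<close>

definition supersolution ::
  "(real^'n::finite) set \<Rightarrow> real \<Rightarrow> real \<Rightarrow> (real^'n \<Rightarrow> real) \<Rightarrow> real \<Rightarrow> real \<Rightarrow> (real^'n \<Rightarrow> real \<Rightarrow> real) \<Rightarrow> bool" where
  "supersolution \<Omega> T \<tau> \<rho> C \<theta> e \<longleftrightarrow>
     (\<forall>x\<in>\<Omega>. \<forall>t\<in>{0<..\<tau>}. \<exists>c \<beta> \<xi>. ell_coeffs C \<theta> c \<beta> \<xi> \<and>
        (\<Sum>l\<in>UNIV. hess e x t (\<xi> l)) + (\<Sum>j\<in>UNIV. \<beta> $ j * pdx j e x t)
          \<le> \<rho> x * (pdt T e x t + c * e x t))"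

section \<open>Restricting functions of class C^{2,1} to time slices and to lines\<close>

lemma cont_ext_slice:
  assumes "cont_ext \<Omega> T G" "t \<in> {0..T}"
  shows "continuous_on \<Omega> (\<lambda>x. G x t)"
proof -
  obtain H where H: "continuous_on (closure \<Omega> \<times> {0..T}) H" "\<And>x. x \<in> \<Omega> \<Longrightarrow> H (x, t) = G x t"
    using assms unfolding cont_ext_def by blast
  have "continuous_on \<Omega> (\<lambda>x. H (x, t))"
    by (rule continuous_on_compose2[OF H(1)])
       (use assms closure_subset[of \<Omega>] in \<open>auto intro!: continuous_intros\<close>)
  then show ?thesis using H(2) by (rule continuous_on_eq)
qed

lemma C21_pdx:
  assumes "C21 \<Omega> T F" "t \<in> {0..T}" "x \<in> \<Omega>"
  shows "((\<lambda>s. F (x + s *\<^sub>R axis j 1) t) has_real_derivative pdx j F x t) (at 0)"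
    and "((\<lambda>s. pdx j F (x + s *\<^sub>R axis k 1) t) has_real_derivative pdx k (pdx j F) x t) (at 0)"
  using assms unfolding C21_def pdx_def
  by (auto simp: DERIV_deriv_iff_real_differentiable)

text \<open>This passes from coordinate partials to derivatives in an arbitrary direction: the
  continuous extensions make each spatial slice of \<open>F\<close> and of its first partials
  totally differentiable.\<close>

lemma C21_line:
  assumes F: "C21 \<Omega> T F" "open \<Omega>" "t \<in> {0..T}" "x + s *\<^sub>R \<xi> \<in> \<Omega>"
  shows "((\<lambda>s. F (x + s *\<^sub>R \<xi>) t) has_real_derivative
            (\<Sum>j\<in>UNIV. \<xi> $ j * pdx j F (x + s *\<^sub>R \<xi>) t)) (at s)" (is ?A)
    and "((\<lambda>s. \<Sum>j\<in>UNIV. \<xi> $ j * pdx j F (x + s *\<^sub>R \<xi>) t) has_real_derivative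
            hess F (x + s *\<^sub>R \<xi>) t \<xi>) (at s)" (is ?B)
proof -
  have c: "continuous_on \<Omega> (\<lambda>x. pdx j F x t)" "continuous_on \<Omega> (\<lambda>x. pdx k (pdx j F) x t)" for j k
    using F unfolding C21_def by (auto intro!: cont_ext_slice[where T=T])
  show ?A
    by (rule line_derivative_continuous_partials[where f="\<lambda>x. F x t", OF F(2,4)])
       (use C21_pdx[OF F(1,3)] c in auto)
  have "((\<lambda>s. pdx j F (x + s *\<^sub>R \<xi>) t) has_real_derivative
            (\<Sum>k\<in>UNIV. \<xi> $ k * pdx k (pdx j F) (x + s *\<^sub>R \<xi>) t)) (at s)" for j
    by (rule line_derivative_continuous_partials[where f="\<lambda>x. pdx j F x t", OF F(2,4)])
       (use C21_pdx[OF F(1,3)] c in auto)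
  then show ?B
    unfolding hess_def mult.assoc sum_distrib_left[symmetric]
    by (intro DERIV_sum DERIV_cmult)
qed

text \<open>In the comparison argument the minimum is known only against earlier times, and
  \<open>t\<close> may be the final time \<open>T\<close>; so only the sign of the left difference
  quotients is available.\<close>

lemma left_derivative_nonpos:
  fixes f :: "real \<Rightarrow> real"
  assumes D: "(f has_real_derivative c) (at t within {0..T})" and t: "0 < t" "t \<le> T"
    and \<delta>: "\<delta> > 0" and min: "\<And>s. t - \<delta> \<le> s \<Longrightarrow> 0 \<le> s \<Longrightarrow> s \<le> t \<Longrightarrow> f t \<le> f s"
  shows "c \<le> 0"
proof (rule tendsto_upperbound)
  have "(f has_real_derivative c) (at t within {0..t})"
    using D t by (auto intro: DERIV_subset)
  then show "((\<lambda>y. (f y - f t) / (y - t)) \<longlongrightarrow> c) (at_left t)"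
    using t by (simp add: has_field_derivative_iff at_within_Icc_at_left)
  have "\<forall>\<^sub>F y in at_left t. y \<in> {max 0 (t - \<delta>)<..<t}"
    by (rule eventually_at_leftI[where a="max 0 (t - \<delta>)"]) (use t \<delta> in auto)
  then show "\<forall>\<^sub>F y in at_left t. (f y - f t) / (y - t) \<le> 0"
    by eventually_elim (use min in \<open>auto intro!: divide_nonneg_neg\<close>)
qed auto

text \<open>First- and second-order conditions at a space minimum of \<open>e - w\<close> that also
  minimizes the weighted difference backwards in time. At fixed \<open>t\<close> the weight is a
  positive constant and does not affect the spatial conditions; in time its derivative produces the
  term with \<open>M\<close>.\<close>

lemma touching_point:
  fixes e w :: "real^'n::finite \<Rightarrow> real \<Rightarrow> real"
  assumes e: "C21 \<Omega> T e" and \<Omega>: "open \<Omega>" "x \<in> \<Omega>" and t: "0 < t" "t \<le> T"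
    and \<delta>: "\<delta> > 0"
    and space: "\<And>y. y \<in> ball x \<delta> \<Longrightarrow> e x t - w x t \<le> e y t - w y t"
    and time: "\<And>s. t - \<delta> \<le> s \<Longrightarrow> 0 \<le> s \<Longrightarrow> s \<le> t \<Longrightarrow>
        exp (- M * t) * (e x t - w x t) \<le> exp (- M * s) * (e x s - w x s)"
    and w1: "\<And>\<xi> s. ((\<lambda>s. w (x + s *\<^sub>R \<xi>) t) has_real_derivative w1 \<xi> s) (at s)"
    and w2: "\<And>\<xi>. (w1 \<xi> has_real_derivative w2 \<xi>) (at 0)"
    and wt: "((\<lambda>s. w x s) has_real_derivative wt) (at t)"
  shows "(\<Sum>j\<in>UNIV. \<xi> $ j * pdx j e x t) = w1 \<xi> 0"
    and "w2 \<xi> \<le> hess e x t \<xi>"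
    and "pdt T e x t \<le> wt + M * (e x t - w x t)"
proof -
  have tT: "t \<in> {0..T}" using t by simp
  obtain r1 where r1: "r1 > 0" "ball x r1 \<subseteq> \<Omega>" using \<Omega> open_contains_ball by blast
  \<comment> \<open>With this \<open>r\<close> all points at parameter below \<open>r\<close> on the
    line stay in both balls; the summand 1 covers the direction \<xi> = 0.\<close>
  define r where "r = min r1 \<delta> / (norm \<xi> + 1)"
  have n1: "norm \<xi> + 1 > 0" by (simp add: add_nonneg_pos)
  have r: "r > 0" using r1 \<delta> n1 by (simp add: r_def)
  have inb: "x + s *\<^sub>R \<xi> \<in> \<Omega> \<and> x + s *\<^sub>R \<xi> \<in> ball x \<delta>" if "\<bar>s\<bar> < r" for s
  proof -
    have "\<bar>s\<bar> * norm \<xi> \<le> \<bar>s\<bar> * (norm \<xi> + 1)" by (simp add: mult_left_mono)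
    also have "\<dots> < r * (norm \<xi> + 1)" using that n1 by simp
    also have "\<dots> = min r1 \<delta>" using n1 by (simp add: r_def)
    finally have "dist x (x + s *\<^sub>R \<xi>) < min r1 \<delta>" by (simp add: dist_norm)
    then show ?thesis using r1 by auto
  qed
  let ?f = "\<lambda>s. e (x + s *\<^sub>R \<xi>) t - w (x + s *\<^sub>R \<xi>) t"
  let ?f' = "\<lambda>s. (\<Sum>j\<in>UNIV. \<xi> $ j * pdx j e (x + s *\<^sub>R \<xi>) t) - w1 \<xi> s"
  have D: "(?f has_real_derivative ?f' s) (at s)" if "\<bar>s\<bar> < r" for s
    using C21_line(1)[OF e \<Omega>(1) tT, of x s \<xi>] inb[OF that] w1 by (intro DERIV_diff) auto
  have D2: "(?f' has_real_derivative (hess e x t \<xi> - w2 \<xi>)) (at 0)"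
    using C21_line(2)[OF e \<Omega>(1) tT, of x 0 \<xi>] \<Omega>(2) w2 by (intro DERIV_diff) auto
  have min: "?f 0 \<le> ?f s" if "\<bar>s\<bar> < r" for s
    using space inb[OF that] by auto
  from second_derivative_local_min[OF r D D2 min]
  show "(\<Sum>j\<in>UNIV. \<xi> $ j * pdx j e x t) = w1 \<xi> 0" "w2 \<xi> \<le> hess e x t \<xi>"
    by auto
  have "((\<lambda>s. e x s) has_real_derivative pdt T e x t) (at t within {0..T})"
    using e \<Omega> tT unfolding C21_def pdt_def has_real_derivative_iff_has_vector_derivative
    by (auto simp: vector_derivative_works)
  then have "((\<lambda>s. exp (- M * s) * (e x s - w x s)) has_real_derivative
      exp (- M * t) * (pdt T e x t - wt - M * (e x t - w x t))) (at t within {0..T})"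
    using DERIV_subset[OF wt, of "{0..T}"]
    by (auto intro!: derivative_eq_intros simp: algebra_simps)
  from left_derivative_nonpos[OF this t \<delta> time]
  show "pdt T e x t \<le> wt + M * (e x t - w x t)"
    by (simp add: mult_le_0_iff)
qed

text \<open>At a negative minimum of \<open>exp (-M t) (e - w)\<close> with \<open>M > C\<close>, positivity of \<open>\<rho>\<close> gives
  the zero-order term a sign, whatever the sign of \<open>c\<close>.\<close>
lemma comparison:
  fixes e w :: "real^'n::finite \<Rightarrow> real \<Rightarrow> real"
  assumes e: "C21 \<Omega> T e" and \<Omega>: "open \<Omega>" and \<tau>: "\<tau> \<le> T"
    and \<rho>: "\<And>x. x \<in> \<Omega> \<Longrightarrow> \<rho> x > 0"
    and super: "supersolution \<Omega> T \<tau> \<rho> C \<theta> e"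
    and D: "compact D" "D \<subseteq> UNIV \<times> {0..\<tau>}"
    and cont: "continuous_on D (\<lambda>(x, t). e x t)" "continuous_on D (\<lambda>(x, t). w x t)"
    and alt: "\<And>x t. (x, t) \<in> D \<Longrightarrow> e x t < w x t \<Longrightarrow>
        x \<in> \<Omega> \<and> 0 < t \<and>
        (\<exists>\<delta>>0. (\<forall>y\<in>ball x \<delta>. (y, t) \<in> D) \<and> (\<forall>s. t - \<delta> \<le> s \<longrightarrow> 0 \<le> s \<longrightarrow> s \<le> t \<longrightarrow> (x, s) \<in> D)) \<and>
        (\<exists>wt w1 w2. (\<forall>\<xi> s. ((\<lambda>s. w (x + s *\<^sub>R \<xi>) t) has_real_derivative w1 \<xi> s) (at s)) \<and>
           (\<forall>\<xi>. (w1 \<xi> has_real_derivative w2 \<xi>) (at 0)) \<and>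
           ((\<lambda>s. w x s) has_real_derivative wt) (at t) \<and>
           (\<forall>c \<beta> \<xi>. ell_coeffs C \<theta> c \<beta> \<xi> \<longrightarrow>
              \<rho> x * (wt + c * w x t) \<le> (\<Sum>l\<in>UNIV. w2 (\<xi> l)) + w1 \<beta> 0))"
    and xt: "(x, t) \<in> D"
  shows "w x t \<le> e x t"
proof (rule ccontr)
  assume "\<not> w x t \<le> e x t"
  then have neg: "e x t - w x t < 0" by simp
  \<comment> \<open>Since \<open>c\<close> is at least \<open>- C\<close>, this gives
    \<open>M + c > 0\<close>.\<close>
  define M where "M = C + 1"
  define g where "g = (\<lambda>(x, t). exp (- M * t) * (e x t - w x t))"
  have "continuous_on D g"
    using cont unfolding g_def case_prod_unfold by (intro continuous_intros)
  then obtain p where p: "p \<in> D" "\<And>q. q \<in> D \<Longrightarrow> g p \<le> g q"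
    using continuous_attains_inf[of D g] D xt by blast
  obtain y s where ys: "p = (y, s)" by fastforce
  have "g (y, s) < 0"
    using p(2)[OF xt] neg unfolding ys by (simp add: g_def) (smt (verit) exp_gt_zero mult_pos_neg)
  then have z: "e y s - w y s < 0" by (simp add: g_def mult_less_0_iff)
  have lt: "e y s < w y s" using z by simp
  \<comment> \<open>The hypothesis on points with \<open>e < w\<close> puts the minimizer off the
    parabolic boundary of \<open>D\<close>: it has a spatial neighbourhood and a backward time
    segment inside \<open>D\<close>, and \<open>w\<close> is a subsolution there.\<close>
  note alt' = alt[OF p(1)[unfolded ys] lt]
  have y: "y \<in> \<Omega>" "0 < s" using alt' by simp_all
  obtain \<delta> where \<delta>: "\<delta> > 0" "\<And>y'. y' \<in> ball y \<delta> \<Longrightarrow> (y', s) \<in> D"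
      "\<And>s'. s - \<delta> \<le> s' \<Longrightarrow> 0 \<le> s' \<Longrightarrow> s' \<le> s \<Longrightarrow> (y, s') \<in> D"
    using alt'[THEN conjunct2, THEN conjunct2, THEN conjunct1] by blast
  from alt'[THEN conjunct2, THEN conjunct2, THEN conjunct2] obtain wt w1 w2
    where W: "(\<forall>\<xi> s'. ((\<lambda>s'. w (y + s' *\<^sub>R \<xi>) s) has_real_derivative w1 \<xi> s') (at s')) \<and>
       (\<forall>\<xi>. (w1 \<xi> has_real_derivative w2 \<xi>) (at 0)) \<and>
       ((\<lambda>s. w y s) has_real_derivative wt) (at s) \<and>
       (\<forall>c \<beta> \<xi>. ell_coeffs C \<theta> c \<beta> \<xi> \<longrightarrow>
          \<rho> y * (wt + c * w y s) \<le> (\<Sum>l\<in>UNIV. w2 (\<xi> l)) + w1 \<beta> 0)"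
    by (elim exE)
  note w = W[THEN conjunct1, rule_format] W[THEN conjunct2, THEN conjunct1, rule_format]
    W[THEN conjunct2, THEN conjunct2, THEN conjunct1]
  note sub = W[THEN conjunct2, THEN conjunct2, THEN conjunct2, rule_format]
  have s: "s \<le> T" "s \<in> {0<..\<tau>}" using p(1) D \<tau> y unfolding ys by auto
  have space: "e y s - w y s \<le> e y' s - w y' s" if "y' \<in> ball y \<delta>" for y'
    using p(2)[OF \<delta>(2)[OF that]] unfolding ys by (simp add: g_def)
  have time: "exp (- M * s) * (e y s - w y s) \<le> exp (- M * s') * (e y s' - w y s')"
    if "s - \<delta> \<le> s'" "0 \<le> s'" "s' \<le> s" for s'
    using p(2)[OF \<delta>(3)[OF that]] unfolding ys by (simp add: g_def)
  note touch = touching_point[OF e \<Omega> y s(1) \<delta>(1) space time w]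
  obtain c \<beta> \<xi> where c: "ell_coeffs C \<theta> c \<beta> \<xi>"
    and le: "(\<Sum>l\<in>UNIV. hess e y s (\<xi> l)) + (\<Sum>j\<in>UNIV. \<beta> $ j * pdx j e y s)
          \<le> \<rho> y * (pdt T e y s + c * e y s)"
    using super y(1) s(2) unfolding supersolution_def by meson
  have "M + c > 0" using c unfolding M_def ell_coeffs_def by auto
  then have neg: "\<rho> y * ((M + c) * (e y s - w y s)) < 0"
    using \<rho>[OF y(1)] z by (intro mult_pos_neg) auto
  \<comment> \<open>At the touching point the subsolution inequality for \<open>w\<close>, the
    touching conditions and the supersolution inequality for \<open>e\<close> close into a loop,
    which returns to its start plus a strictly negative term.\<close>
  have "\<rho> y * (wt + c * w y s) \<le> (\<Sum>l\<in>UNIV. w2 (\<xi> l)) + w1 \<beta> 0"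
    by (rule sub[OF c])
  also have "\<dots> \<le> (\<Sum>l\<in>UNIV. hess e y s (\<xi> l)) + (\<Sum>j\<in>UNIV. \<beta> $ j * pdx j e y s)"
    using touch by (auto intro!: sum_mono)
  also note le
  also have "\<rho> y * (pdt T e y s + c * e y s) \<le> \<rho> y * (wt + M * (e y s - w y s) + c * e y s)"
    using touch(3) \<rho>[OF y(1)] by (intro mult_left_mono) auto
  also have "\<dots> = \<rho> y * (wt + c * w y s) + \<rho> y * ((M + c) * (e y s - w y s))"
    by (simp add: algebra_simps)
  finally show False using neg by simp
qed

section \<open>A growing-ball barrier\<close>

text \<open>A Gaussian Hopf barrier shifted so that its zero set at time \<open>t\<close> is the
  sphere of radius \<open>r0 + q * t\<close> about \<open>a\<close>; inside that sphere it is
  positive.\<close>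

definition barrier :: "real \<Rightarrow> real \<Rightarrow> real^'n::finite \<Rightarrow> real \<Rightarrow> real \<Rightarrow> real^'n \<Rightarrow> real \<Rightarrow> real" where
  "barrier \<epsilon> K a r0 q x t = \<epsilon> * (exp (- K * ((x - a) \<bullet> (x - a))) - exp (- K * (r0 + q * t)\<^sup>2))"

text \<open>Away from the centre, ellipticity contributes a term of order \<open>K\<^sup>2\<close>,
  while drift, trace, zero-order and time terms are all of order \<open>K\<close>. Dividing the
  required inequality by the common factor \<open>\<epsilon> * E * K\<close> leaves the condition
  \<open>big\<close>.\<close>

lemma barrier_subsolution:
  fixes a x :: "real^'n::finite"
  assumes \<epsilon>: "\<epsilon> > 0" and r0: "r0 > 0" and q: "q \<ge> 0" and t: "t \<ge> 0"
    and x: "r0 \<le> norm (x - a)" "norm (x - a) \<le> r0 + q * t" "r0 + q * t \<le> d"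
    and \<rho>: "0 \<le> \<rho>" "\<rho> \<le> P" and K: "K \<ge> 1" and C: "C \<ge> 0" and \<theta>: "\<theta> \<ge> 0"
    and big: "P * (2 * d * q + C) + 2 * real CARD('n) * C\<^sup>2 + 2 * d * C \<le> 4 * K * \<theta> * r0\<^sup>2"
  shows "\<exists>wt w1 w2. (\<forall>\<xi> s. ((\<lambda>s. barrier \<epsilon> K a r0 q (x + s *\<^sub>R \<xi>) t) has_real_derivative w1 \<xi> s) (at s)) \<and>
           (\<forall>\<xi>. (w1 \<xi> has_real_derivative w2 \<xi>) (at 0)) \<and>
           ((\<lambda>s. barrier \<epsilon> K a r0 q x s) has_real_derivative wt) (at t) \<and>
           (\<forall>c \<beta> \<xi>. ell_coeffs C \<theta> c \<beta> \<xi> \<longrightarrow>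
              \<rho> * (wt + c * barrier \<epsilon> K a r0 q x t) \<le> (\<Sum>l\<in>(UNIV :: 'n set). w2 (\<xi> l)) + w1 \<beta> 0)"
proof -
  define E where "E = exp (- K * ((x - a) \<bullet> (x - a)))"
  define r where "r = r0 + q * t"
  define wt where "wt = \<epsilon> * (2 * K * q * r * exp (- K * r\<^sup>2))"
  define w1 where "w1 \<xi> s = \<epsilon> * (- 2 * K * ((x + s *\<^sub>R \<xi> - a) \<bullet> \<xi>) *
      exp (- K * ((x + s *\<^sub>R \<xi> - a) \<bullet> (x + s *\<^sub>R \<xi> - a))))" for \<xi> :: "real^'n" and s
  define w2 where "w2 \<xi> = \<epsilon> * ((4 * K\<^sup>2 * ((x - a) \<bullet> \<xi>)\<^sup>2 - 2 * K * (\<xi> \<bullet> \<xi>)) * E)" for \<xi> :: "real^'n"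
  have 1: "(x + s *\<^sub>R \<xi> - a) \<bullet> (x + s *\<^sub>R \<xi> - a)
      = (x - a) \<bullet> (x - a) + 2 * s * ((x - a) \<bullet> \<xi>) + s\<^sup>2 * (\<xi> \<bullet> \<xi>)" for \<xi> s
    by (simp add: algebra_simps inner_simps inner_commute power2_eq_square)
  have 2: "(x + s *\<^sub>R \<xi> - a) \<bullet> \<xi> = (x - a) \<bullet> \<xi> + s * (\<xi> \<bullet> \<xi>)" for \<xi> s
    by (simp add: algebra_simps inner_simps)
  have D1: "((\<lambda>s. barrier \<epsilon> K a r0 q (x + s *\<^sub>R \<xi>) t) has_real_derivative w1 \<xi> s) (at s)" for \<xi> s
    unfolding barrier_def w1_def 1 2
    by (auto intro!: derivative_eq_intros simp: algebra_simps)
  have D2: "(w1 \<xi> has_real_derivative w2 \<xi>) (at 0)" for \<xi>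
  proof -
    have w1: "w1 \<xi> = (\<lambda>s. \<epsilon> * (- 2 * K * ((x - a) \<bullet> \<xi> + s * (\<xi> \<bullet> \<xi>)) *
      exp (- K * ((x - a) \<bullet> (x - a) + 2 * s * ((x - a) \<bullet> \<xi>) + s\<^sup>2 * (\<xi> \<bullet> \<xi>)))))"
      unfolding w1_def 1 2[of _ \<xi>] ..
    show ?thesis
      unfolding w1 w2_def E_def
      by (auto intro!: derivative_eq_intros simp: algebra_simps power2_eq_square)
  qed
  have Dt: "((\<lambda>s. barrier \<epsilon> K a r0 q x s) has_real_derivative wt) (at t)"
    unfolding barrier_def wt_def r_def
    by (auto intro!: derivative_eq_intros simp: algebra_simps power2_eq_square)
  have E: "E > 0" by (simp add: E_def)
  have rpos: "r > 0" "r \<le> d" using r0 q t x by (auto simp: r_def add_pos_nonneg)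
  have nx: "(x - a) \<bullet> (x - a) = (norm (x - a))\<^sup>2" by (simp add: power2_norm_eq_inner)
  have "(norm (x - a))\<^sup>2 \<le> r\<^sup>2" using x by (intro power_mono) (auto simp: r_def)
  \<comment> \<open>Inside the moving sphere the time derivative and the barrier itself are both
    controlled by the same Gaussian \<open>E\<close> that multiplies the spatial terms.\<close>
  then have ErE: "exp (- K * r\<^sup>2) \<le> E"
    unfolding E_def nx using K by simp
  have P: "P \<ge> 0" using \<rho> by simp
  have wt_le: "wt \<le> \<epsilon> * (2 * K * q * d * E)"
    unfolding wt_def using \<epsilon> K q rpos ErE by (intro mult_left_mono mult_mono) auto
  have ineq: "\<rho> * (wt + c * barrier \<epsilon> K a r0 q x t) \<le> (\<Sum>l\<in>(UNIV :: 'n set). w2 (\<xi> l)) + w1 \<beta> 0"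
    if co: "ell_coeffs C \<theta> c \<beta> \<xi>" for c \<beta> \<xi>
  proof -
    have c: "\<bar>c\<bar> \<le> C" "norm \<beta> \<le> C" "\<And>l. norm (\<xi> l) \<le> C"
      "\<theta> * (norm (x - a))\<^sup>2 \<le> (\<Sum>l\<in>UNIV. ((x - a) \<bullet> \<xi> l)\<^sup>2)"
      using co unfolding ell_coeffs_def by auto
    have b0: "0 \<le> barrier \<epsilon> K a r0 q x t" "barrier \<epsilon> K a r0 q x t \<le> \<epsilon> * E"
      using \<epsilon> ErE by (auto simp: barrier_def E_def r_def)
    have "c * barrier \<epsilon> K a r0 q x t \<le> C * (\<epsilon> * E)"
      using b0 c(1) C by (intro mult_mono) auto
    \<comment> \<open>The bound \<open>K \<ge> 1\<close> raises the zero-order term to order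
      \<open>K\<close>, so that it can be merged with the time derivative.\<close>
    also have "\<dots> \<le> \<epsilon> * (K * C * E)"
      using K C \<epsilon> E mult_right_mono[of 1 K "\<epsilon> * (C * E)"] by (simp add: algebra_simps)
    finally have "wt + c * barrier \<epsilon> K a r0 q x t \<le> \<epsilon> * (K * (2 * d * q + C) * E)"
      using wt_le by (simp add: algebra_simps)
    then have "\<rho> * (wt + c * barrier \<epsilon> K a r0 q x t) \<le> \<rho> * (\<epsilon> * (K * (2 * d * q + C) * E))"
      using \<rho> by (intro mult_left_mono)
    also have "\<dots> \<le> P * (\<epsilon> * (K * (2 * d * q + C) * E))"
      using \<rho> \<epsilon> K C q rpos E by (intro mult_right_mono) auto
    also have "\<dots> = \<epsilon> * E * K * (P * (2 * d * q + C))" by (simp add: algebra_simps)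
    also have "\<dots> \<le> \<epsilon> * E * K * (4 * K * \<theta> * r0\<^sup>2 - 2 * real CARD('n) * C\<^sup>2 - 2 * d * C)"
      using big \<epsilon> E K by (intro mult_left_mono) auto
    also have "\<dots> = \<epsilon> * (4 * K\<^sup>2 * (\<theta> * r0\<^sup>2) - 2 * K * (real CARD('n) * C\<^sup>2)) * E - \<epsilon> * (2 * K * (d * C) * E)"
      by (simp add: algebra_simps power2_eq_square)
    also have "\<dots> \<le> (\<Sum>l\<in>(UNIV :: 'n set). w2 (\<xi> l)) + w1 \<beta> 0"
    proof -
      have "\<theta> * r0\<^sup>2 \<le> \<theta> * (norm (x - a))\<^sup>2"
        using r0 x \<theta> by (intro mult_left_mono power_mono) auto
      then have s1: "\<theta> * r0\<^sup>2 \<le> (\<Sum>l\<in>UNIV. ((x - a) \<bullet> \<xi> l)\<^sup>2)" using c(4) by simp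
      have s2: "(\<Sum>l\<in>UNIV. \<xi> l \<bullet> \<xi> l) \<le> real CARD('n) * C\<^sup>2"
        using sum_bounded_above[of UNIV "\<lambda>l. \<xi> l \<bullet> \<xi> l" "C\<^sup>2"] c(3)
        by (simp add: power2_norm_eq_inner[symmetric] power_mono)
      have "(\<Sum>l\<in>(UNIV :: 'n set). w2 (\<xi> l)) =
          \<epsilon> * (4 * K\<^sup>2 * (\<Sum>l\<in>UNIV. ((x - a) \<bullet> \<xi> l)\<^sup>2) - 2 * K * (\<Sum>l\<in>UNIV. \<xi> l \<bullet> \<xi> l)) * E"
        unfolding w2_def by (simp add: sum_distrib_left sum_distrib_right sum_subtractf algebra_simps)
      moreover have "\<epsilon> * (4 * K\<^sup>2 * (\<theta> * r0\<^sup>2) - 2 * K * (real CARD('n) * C\<^sup>2)) * E \<le>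
          \<epsilon> * (4 * K\<^sup>2 * (\<Sum>l\<in>UNIV. ((x - a) \<bullet> \<xi> l)\<^sup>2) - 2 * K * (\<Sum>l\<in>UNIV. \<xi> l \<bullet> \<xi> l)) * E"
        using s1 s2 \<epsilon> E K by (intro mult_right_mono mult_left_mono diff_mono) auto
      moreover have "- (\<epsilon> * (2 * K * (d * C) * E)) \<le> w1 \<beta> 0"
      proof -
        have "(x - a) \<bullet> \<beta> \<le> norm (x - a) * norm \<beta>" by (rule norm_cauchy_schwarz)
        also have "\<dots> \<le> d * C" using x c C rpos by (intro mult_mono) auto
        finally have "\<epsilon> * (2 * K * ((x - a) \<bullet> \<beta>) * E) \<le> \<epsilon> * (2 * K * (d * C) * E)"
          using \<epsilon> K E by (intro mult_left_mono mult_right_mono) auto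
        then show ?thesis by (simp add: w1_def E_def)
      qed
      ultimately show ?thesis by simp
    qed
    finally show ?thesis .
  qed
  show ?thesis
    by (intro exI[of _ wt] exI[of _ w1] exI[of _ w2]) (use D1 D2 Dt ineq in blast)
qed

section \<open>Hopf-type contradiction\<close>

text \<open>Comparison with the zero function on the whole closed cylinder: a negative value can
  occur neither at time 0 nor on the lateral boundary.\<close>

lemma supersolution_nonneg:
  fixes e :: "real^'n::finite \<Rightarrow> real \<Rightarrow> real"
  assumes \<Omega>: "bounded \<Omega>" "open \<Omega>" and \<tau>: "0 < \<tau>" "\<tau> \<le> T" and e: "C21 \<Omega> T e"
    and super: "supersolution \<Omega> T \<tau> \<rho> C \<theta> e"
    and \<rho>: "\<And>x. x \<in> \<Omega> \<Longrightarrow> \<rho> x > 0"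
    and init: "\<And>x. x \<in> \<Omega> \<Longrightarrow> e x 0 \<ge> 0"
    and bdry: "\<And>x t. x \<in> frontier \<Omega> \<Longrightarrow> 0 < t \<Longrightarrow> t \<le> \<tau> \<Longrightarrow> e x t = 0"
    and xt: "x \<in> closure \<Omega>" "t \<in> {0..\<tau>}"
  shows "0 \<le> e x t"
proof (rule comparison[where w="\<lambda>_ _. 0" and D="closure \<Omega> \<times> {0..\<tau>}", OF e \<Omega>(2) \<tau>(2) \<rho> super])
  show "compact (closure \<Omega> \<times> {0..\<tau>})"
    using \<Omega> by (intro compact_Times) auto
  have c: "continuous_on (closure \<Omega> \<times> {0..T}) (\<lambda>(x, t). e x t)"
    using e unfolding C21_def by blast
  then show ce: "continuous_on (closure \<Omega> \<times> {0..\<tau>}) (\<lambda>(x, t). e x t)"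
    by (rule continuous_on_subset) (use \<tau> in auto)
  show "(x, t) \<in> closure \<Omega> \<times> {0..\<tau>}" using xt by simp
  \<comment> \<open>The initial sign is given on \<Omega> and the boundary values only for positive
    times; continuity covers the frontier at time 0.\<close>
  have "continuous_on (closure \<Omega>) (\<lambda>x. e x 0)"
    using continuous_on_compose2[OF c, of "closure \<Omega>" "\<lambda>x. (x, 0)"] \<tau>
    by (simp add: continuous_on_Pair subset_iff image_iff)
  then have init': "e y 0 \<ge> 0" if "y \<in> closure \<Omega>" for y
    using continuous_ge_on_closure[of \<Omega> "\<lambda>x. e x 0" y 0] init that by auto
  fix y s assume ys: "(y, s) \<in> closure \<Omega> \<times> {0..\<tau>}" and neg: "e y s < 0"
  have s: "0 < s" "s \<le> \<tau>" using init'[of y] ys neg by (auto intro: le_neq_trans)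
  have y: "y \<in> \<Omega>" using bdry[of y s] s ys neg \<Omega>(2) by (auto simp: frontier_def interior_open)
  obtain \<delta> where "\<delta> > 0" "ball y \<delta> \<subseteq> \<Omega>" using y \<Omega> open_contains_ball by blast
  then have "\<exists>\<delta>>0. (\<forall>y'\<in>ball y \<delta>. (y', s) \<in> closure \<Omega> \<times> {0..\<tau>}) \<and>
      (\<forall>s'. s - \<delta> \<le> s' \<longrightarrow> 0 \<le> s' \<longrightarrow> s' \<le> s \<longrightarrow> (y, s') \<in> closure \<Omega> \<times> {0..\<tau>})"
    using s ys closure_subset[of \<Omega>] by (intro exI[of _ \<delta>]) auto
  moreover have "\<exists>wt w1 w2. (\<forall>(\<xi> :: real^'n) s. ((\<lambda>s. (0 :: real)) has_real_derivative w1 \<xi> s) (at s)) \<and>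
           (\<forall>\<xi>. (w1 \<xi> has_real_derivative w2 \<xi>) (at 0)) \<and>
           ((\<lambda>s. 0) has_real_derivative wt) (at s) \<and>
           (\<forall>c \<beta> \<xi>. ell_coeffs C \<theta> c \<beta> \<xi> \<longrightarrow>
              \<rho> y * (wt + c * 0) \<le> (\<Sum>l\<in>(UNIV :: 'n set). w2 (\<xi> l)) + w1 \<beta> 0)"
    by (intro exI[of _ 0] exI[of _ "\<lambda>_ _. 0"] exI[of _ "\<lambda>_. 0"]) auto
  ultimately show "y \<in> \<Omega> \<and> 0 < s \<and> (\<exists>\<delta>>0. (\<forall>y'\<in>ball y \<delta>. (y', s) \<in> closure \<Omega> \<times> {0..\<tau>}) \<and>
      (\<forall>s'. s - \<delta> \<le> s' \<longrightarrow> 0 \<le> s' \<longrightarrow> s' \<le> s \<longrightarrow> (y, s') \<in> closure \<Omega> \<times> {0..\<tau>})) \<and>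
      (\<exists>wt w1 w2. (\<forall>(\<xi> :: real^'n) s. ((\<lambda>s. (0 :: real)) has_real_derivative w1 \<xi> s) (at s)) \<and>
           (\<forall>\<xi>. (w1 \<xi> has_real_derivative w2 \<xi>) (at 0)) \<and>
           ((\<lambda>s. 0) has_real_derivative wt) (at s) \<and>
           (\<forall>c \<beta> \<xi>. ell_coeffs C \<theta> c \<beta> \<xi> \<longrightarrow>
              \<rho> y * (wt + c * 0) \<le> (\<Sum>l\<in>(UNIV :: 'n set). w2 (\<xi> l)) + w1 \<beta> 0))"
    using y s by blast
qed auto

text \<open>On the segment from the touching point \<open>p\<close> towards \<open>x0\<close>, at
  the time when the growing ball reaches \<open>p\<close>, the barrier forces \<open>e\<close> to
  rise at least at rate \<kappa> in the segment parameter. The vanishing gradient near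
  \<open>p\<close> allows at most half of that.\<close>

lemma no_supersolution:
  fixes e :: "real^'n::finite \<Rightarrow> real \<Rightarrow> real"
  assumes \<Omega>: "bounded \<Omega>" "open \<Omega>" and \<tau>: "0 < \<tau>" "\<tau> \<le> T" and e: "C21 \<Omega> T e"
    and super: "supersolution \<Omega> T \<tau> \<rho> C \<theta> e" and C: "C \<ge> 0" and \<theta>: "\<theta> > 0"
    and \<rho>: "\<And>x. x \<in> \<Omega> \<Longrightarrow> \<rho> x > 0" "continuous_on (closure \<Omega>) \<rho>"
    and init: "\<And>x. x \<in> \<Omega> \<Longrightarrow> e x 0 \<ge> 0" and x0: "x0 \<in> \<Omega>" "e x0 0 > 0"
    and bdry: "\<And>x t. x \<in> frontier \<Omega> \<Longrightarrow> 0 < t \<Longrightarrow> t \<le> \<tau> \<Longrightarrow> e x t = 0"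
    and grad: "\<And>x t i. x \<in> frontier \<Omega> \<Longrightarrow> 0 < t \<Longrightarrow> t \<le> \<tau> \<Longrightarrow>
        ((\<lambda>(y, s). pdx i e y s) \<longlongrightarrow> 0) (at (x, t) within \<Omega> \<times> {0..T})"
  shows False
proof -
  note nonneg = supersolution_nonneg[OF \<Omega> \<tau> e super \<rho>(1) init bdry]
  have c: "continuous_on (closure \<Omega> \<times> {0..T}) (\<lambda>(x, t). e x t)"
    using e unfolding C21_def by blast
  \<comment> \<open>With half the initial value as threshold, continuity keeps \<open>e\<close>
    above \<open>m\<close> on a small ball for a short time. This supplies the inner boundary values
    for the barrier.\<close>
  define m where "m = e x0 0 / 2"
  have m: "m > 0" using x0 by (simp add: m_def)
  have "(x0, 0) \<in> closure \<Omega> \<times> {0..T}" using x0 \<tau> closure_subset[of \<Omega>] by auto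
  then obtain \<delta> where \<delta>0: "\<delta> > 0" "\<forall>z\<in>closure \<Omega> \<times> {0..T}. dist z (x0, 0) < \<delta> \<longrightarrow>
      dist (case z of (x, t) \<Rightarrow> e x t) (case (x0, 0) of (x, t) \<Rightarrow> e x t) < m"
    using c m unfolding continuous_on_iff by blast
  have \<delta>: "\<delta> > 0" "\<And>y s. y \<in> closure \<Omega> \<Longrightarrow> s \<in> {0..T} \<Longrightarrow> dist (y, s) (x0, 0) < \<delta> \<Longrightarrow>
      \<bar>e y s - e x0 0\<bar> < m"
    using \<delta>0 by (fastforce simp: dist_real_def)+
  obtain \<delta>' where \<delta>': "\<delta>' > 0" "ball x0 \<delta>' \<subseteq> \<Omega>" using x0 \<Omega> open_contains_ball by blast
  \<comment> \<open>The thirds make \<open>r0 + t1\<close> smaller than \<delta>, which bounds the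
    distance in space-time from \<open>(x0, 0)\<close>.\<close>
  define r0 where "r0 = min \<delta> \<delta>' / 3"
  define t1 where "t1 = min \<tau> (\<delta> / 3)"
  have r0: "r0 > 0" "r0 < \<delta>'" and t1: "0 < t1" "t1 \<le> \<tau>"
    using \<delta> \<delta>' \<tau> by (auto simp: r0_def t1_def)
  have em: "m \<le> e y s" if "dist x0 y \<le> r0" "s \<in> {0..t1}" for y s
  proof -
    have "dist (y, s) (x0, 0) \<le> dist y x0 + dist s 0"
      unfolding dist_Pair_Pair by (rule order_trans[OF sqrt_sum_squares_le_sum]) auto
    also have "\<dots> \<le> r0 + t1" using that by (auto simp: dist_commute dist_real_def)
    also have "\<dots> < \<delta>" using \<delta>(1) by (simp add: r0_def t1_def min_def)
    finally have near: "dist (y, s) (x0, 0) < \<delta>" .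
    have "y \<in> ball x0 \<delta>'" using that r0 by simp
    then have "y \<in> closure \<Omega>" using \<delta>' closure_subset[of \<Omega>] by blast
    then have "\<bar>e y s - e x0 0\<bar> < m"
      using that t1 \<tau> near by (intro \<delta>(2)) auto
    then show ?thesis unfolding m_def by (simp add: abs_if split: if_splits)
  qed
  have "\<Omega> \<noteq> UNIV" using \<Omega>(1) not_bounded_UNIV by auto
  then obtain p where p: "p \<in> - \<Omega>" "\<And>y. y \<in> - \<Omega> \<Longrightarrow> dist x0 p \<le> dist x0 y"
    using distance_attains_inf[of "- \<Omega>" x0] \<Omega>(2) by (auto simp: closed_Compl)
  define d where "d = dist x0 p"
  \<comment> \<open>The open ball up to the nearest point of the complement lies in \<Omega> and
    touches the frontier at \<open>p\<close>: the interior ball of the Hopf argument.\<close>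
  have ball_d: "ball x0 d \<subseteq> \<Omega>" using p(2) by (force simp: d_def)
  have dr: "d > r0" using \<delta>' r0 p(1) by (force simp: d_def)
  have cball_d: "cball x0 d \<subseteq> closure \<Omega>"
    using closure_mono[OF ball_d] dr r0 by simp
  have pf: "p \<in> frontier \<Omega>"
    using cball_d p(1) \<Omega>(2) by (auto simp: frontier_def interior_open d_def)
  \<comment> \<open>The speed at which the radius grows from \<open>r0\<close> to exactly
    \<open>d\<close> at time \<open>t1\<close>.\<close>
  define q where "q = (d - r0) / t1"
  have q: "q > 0" using dr t1 by (simp add: q_def)
  have qt1: "r0 + q * t1 = d" using t1 by (simp add: q_def)
  have rd: "r0 + q * t \<le> d" if "t \<le> t1" for t
    using that q qt1 by (metis add_left_mono less_imp_le mult_left_mono)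
  obtain P where P: "\<And>x. x \<in> closure \<Omega> \<Longrightarrow> \<rho> x \<le> P"
    using compact_imp_bounded[OF compact_continuous_image[OF \<rho>(2)]] \<Omega>(1)
    by (auto simp: bounded_real abs_le_iff)
  define Q where "Q = P * (2 * d * q + C) + 2 * real CARD('n) * C\<^sup>2 + 2 * d * C"
  define K where "K = max 1 (Q / (4 * \<theta> * r0\<^sup>2))"
  have K: "K \<ge> 1" by (simp add: K_def)
  have big: "Q \<le> 4 * K * \<theta> * r0\<^sup>2"
  proof -
    have "Q = Q / (4 * \<theta> * r0\<^sup>2) * (4 * \<theta> * r0\<^sup>2)" using \<theta> r0 by simp
    also have "\<dots> \<le> K * (4 * \<theta> * r0\<^sup>2)" using \<theta> r0 by (intro mult_right_mono) (auto simp: K_def)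
    finally show ?thesis by (simp add: algebra_simps)
  qed
  \<comment> \<open>A growing annulus that degenerates to the sphere of radius \<open>r0\<close> at
    time 0. Thus the initial slice is already part of the inner boundary and needs no separate
    comparison.\<close>
  define D where "D = {(x, t). x \<in> cball x0 d \<and> t \<in> {0..t1} \<and> r0 \<le> norm (x - x0) \<and> norm (x - x0) \<le> r0 + q * t}"
  have Deq: "D = (cball x0 d \<times> {0..t1}) \<inter> {z. r0 \<le> norm (fst z - x0)} \<inter> {z. norm (fst z - x0) \<le> r0 + q * snd z}"
    by (auto simp: D_def)
  have Dcomp: "compact D"
    unfolding Deq
    by (intro compact_Int_closed compact_Times closed_Collect_le continuous_intros) auto
  have below: "barrier m K x0 r0 q x t \<le> e x t" if xt: "(x, t) \<in> D" for x t
  proof (rule comparison[OF e \<Omega>(2) \<tau>(2) \<rho>(1) super Dcomp _ _ _ _ xt])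
    show "D \<subseteq> UNIV \<times> {0..\<tau>}" using t1 by (auto simp: D_def)
    show "continuous_on D (\<lambda>(x, t). e x t)"
      by (rule continuous_on_subset[OF c]) (use cball_d t1 \<tau> in \<open>auto simp: D_def\<close>)
    show "continuous_on D (\<lambda>(x, t). barrier m K x0 r0 q x t)"
      unfolding barrier_def case_prod_unfold by (intro continuous_intros)
  next
    fix y s assume ys: "(y, s) \<in> D" and lt: "e y s < barrier m K x0 r0 q y s"
    have yD: "dist x0 y \<le> d" "0 \<le> s" "s \<le> t1" "r0 \<le> norm (y - x0)" "norm (y - x0) \<le> r0 + q * s"
      using ys by (auto simp: D_def)
    \<comment> \<open>On the inner sphere the barrier is at most \<open>m\<close>, which
      \<open>e\<close> dominates there.\<close>
    have "norm (y - x0) \<noteq> r0"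
    proof
      assume "norm (y - x0) = r0"
      then have "m \<le> e y s" using yD by (intro em) (auto simp: dist_norm norm_minus_commute)
      moreover have "barrier m K x0 r0 q y s \<le> m * (1 - 0)"
        unfolding barrier_def using m K by (intro mult_left_mono diff_mono) (auto simp: mult_nonneg_nonneg)
      ultimately show False using lt by simp
    qed
    then have y1: "r0 < norm (y - x0)" using yD by simp
    \<comment> \<open>On the outer moving sphere the barrier vanishes and nonnegativity of
      \<open>e\<close> suffices.\<close>
    have "norm (y - x0) \<noteq> r0 + q * s"
    proof
      assume "norm (y - x0) = r0 + q * s"
      then have "barrier m K x0 r0 q y s = 0"
        by (simp add: barrier_def power2_norm_eq_inner[symmetric])
      moreover have "0 \<le> e y s" using nonneg[of y s] cball_d yD t1 by auto
      ultimately show False using lt by simp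
    qed
    then have y2: "norm (y - x0) < r0 + q * s" using yD by simp
    have s0: "s > 0" using y1 y2 q by (smt (verit) mult_nonneg_nonpos yD(2))
    have yd: "norm (y - x0) < d" using y2 rd[OF yD(3)] by simp
    then have y\<Omega>: "y \<in> \<Omega>" using ball_d by (auto simp: dist_norm norm_minus_commute)
    \<comment> \<open>The first two entries give room in space on both sides of the annulus. The
      third is the time the moving sphere took to cover the remaining gap, so going back by less
      keeps the point inside.\<close>
    define \<eta> where "\<eta> = min (norm (y - x0) - r0) (min (r0 + q * s - norm (y - x0)) ((r0 + q * s - norm (y - x0)) / q))"
    have \<eta>: "\<eta> > 0" using y1 y2 q by (simp add: \<eta>_def)
    have n1: "(y', s) \<in> D" if "y' \<in> ball y \<eta>" for y'
    proof -
      have "norm (y' - y) < \<eta>" using that by (simp add: dist_norm norm_minus_commute)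
      moreover have "\<bar>norm (y' - x0) - norm (y - x0)\<bar> \<le> norm (y' - y)"
        using norm_triangle_ineq3[of "y' - x0" "y - x0"] by simp
      ultimately have "r0 \<le> norm (y' - x0)" "norm (y' - x0) \<le> r0 + q * s"
        by (auto simp: \<eta>_def)
      then show ?thesis using yD rd[OF yD(3)] by (auto simp: D_def dist_norm norm_minus_commute)
    qed
    have n2: "(y, s') \<in> D" if "s - \<eta> \<le> s'" "0 \<le> s'" "s' \<le> s" for s'
    proof -
      have "q * (s - s') \<le> q * ((r0 + q * s - norm (y - x0)) / q)"
        using that q by (intro mult_left_mono) (auto simp: \<eta>_def)
      also have "\<dots> = r0 + q * s - norm (y - x0)" using q by simp
      finally have "norm (y - x0) \<le> r0 + q * s'" by (simp add: algebra_simps)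
      then show ?thesis using yD that by (auto simp: D_def)
    qed
    have "0 \<le> \<rho> y" "\<rho> y \<le> P" using \<rho>(1)[OF y\<Omega>] P[of y] y\<Omega> closure_subset[of \<Omega>] by auto
    note sub = barrier_subsolution[OF m r0(1) less_imp_le[OF q] yD(2,4,5) rd[OF yD(3)] this K C
        less_imp_le[OF \<theta>] big[unfolded Q_def]]
    show "y \<in> \<Omega> \<and> 0 < s \<and>
        (\<exists>\<delta>>0. (\<forall>y'\<in>ball y \<delta>. (y', s) \<in> D) \<and> (\<forall>s'. s - \<delta> \<le> s' \<longrightarrow> 0 \<le> s' \<longrightarrow> s' \<le> s \<longrightarrow> (y, s') \<in> D)) \<and>
        (\<exists>wt w1 w2. (\<forall>\<xi> s'. ((\<lambda>s'. barrier m K x0 r0 q (y + s' *\<^sub>R \<xi>) s) has_real_derivative w1 \<xi> s') (at s')) \<and>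
           (\<forall>\<xi>. (w1 \<xi> has_real_derivative w2 \<xi>) (at 0)) \<and>
           ((\<lambda>s. barrier m K x0 r0 q y s) has_real_derivative wt) (at s) \<and>
           (\<forall>c \<beta> \<xi>. ell_coeffs C \<theta> c \<beta> \<xi> \<longrightarrow>
              \<rho> y * (wt + c * barrier m K x0 r0 q y s) \<le> (\<Sum>l\<in>(UNIV :: 'n set). w2 (\<xi> l)) + w1 \<beta> 0))"
      by (intro conjI y\<Omega> s0 sub exI[of _ \<eta>] \<eta>) (use n1 n2 in blast)+
  qed
  define \<nu> where "\<nu> = x0 - p"
  have n\<nu>: "norm \<nu> = d" by (simp add: \<nu>_def d_def dist_norm)
  have d0: "d > 0" using dr r0 by simp
  \<comment> \<open>\<open>s * \<kappa>\<close> will bound the barrier from below at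
    \<open>p + s *\<^sub>R \<nu>\<close>; this \<kappa> is local to the argument and is not the heat
    conductivity.\<close>
  define \<kappa> where "\<kappa> = m * (exp (- K * d\<^sup>2) * (K * d\<^sup>2))"
  have \<kappa>: "\<kappa> > 0" using m K d0 by (simp add: \<kappa>_def)
  \<comment> \<open>If every partial of \<open>e\<close> is below \<alpha>, the derivative along
    \<nu>, whose entries are at most \<open>d\<close> in modulus, is at most
    \<open>\<kappa> / 2\<close>.\<close>
  define \<alpha> where "\<alpha> = \<kappa> / (2 * d * real CARD('n))"
  have \<alpha>: "\<alpha> > 0" using \<kappa> d0 by (simp add: \<alpha>_def)
  have "\<forall>i. \<exists>\<delta>>0. \<forall>y\<in>\<Omega>. dist y p < \<delta> \<longrightarrow> \<bar>pdx i e y t1\<bar> < \<alpha>"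
  proof
    fix i
    have "\<forall>\<^sub>F z in at (p, t1) within \<Omega> \<times> {0..T}. dist (case z of (y, s) \<Rightarrow> pdx i e y s) 0 < \<alpha>"
      by (rule tendstoD[OF grad[OF pf t1] \<alpha>])
    then obtain \<delta> where \<delta>: "\<delta> > 0" "\<And>z. z \<in> \<Omega> \<times> {0..T} \<Longrightarrow> z \<noteq> (p, t1) \<Longrightarrow> dist z (p, t1) < \<delta> \<Longrightarrow>
        dist (case z of (y, s) \<Rightarrow> pdx i e y s) 0 < \<alpha>"
      unfolding eventually_at by blast
    have "\<bar>pdx i e y t1\<bar> < \<alpha>" if "y \<in> \<Omega>" "dist y p < \<delta>" for y
    proof -
      \<comment> \<open>The limit is punctured at \<open>(p, t1)\<close>, but \<open>p\<close> lies
        outside \<Omega>, so the whole time slice is available.\<close>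
      have "(y, t1) \<in> \<Omega> \<times> {0..T}" "(y, t1) \<noteq> (p, t1)" using that p(1) t1 \<tau> by auto
      moreover have "dist (y, t1) (p, t1) < \<delta>" using that by (simp add: dist_Pair_Pair)
      ultimately show ?thesis using \<delta>(2)[of "(y, t1)"] by simp
    qed
    then show "\<exists>\<delta>>0. \<forall>y\<in>\<Omega>. dist y p < \<delta> \<longrightarrow> \<bar>pdx i e y t1\<bar> < \<alpha>"
      using \<delta>(1) by blast
  qed
  then obtain \<delta>i where \<delta>i: "\<And>i. \<delta>i i > 0" "\<And>i y. y \<in> \<Omega> \<Longrightarrow> dist y p < \<delta>i i \<Longrightarrow> \<bar>pdx i e y t1\<bar> < \<alpha>"
    by metis
  define \<delta>m where "\<delta>m = Min (range \<delta>i)"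
  have \<delta>m: "\<delta>m > 0" "\<And>i. \<delta>m \<le> \<delta>i i" using \<delta>i by (auto simp: \<delta>m_def)
  \<comment> \<open>The first bound keeps the point outside the inner sphere, and the second keeps
    it, with a factor 2 to spare, where all partials are small.\<close>
  define s where "s = min (1 - r0 / d) (\<delta>m / (2 * d))"
  have s: "0 < s" "s \<le> 1 - r0 / d" "s * d < \<delta>m"
  proof -
    show "0 < s" using dr d0 \<delta>m by (simp add: s_def)
    have "s * d \<le> \<delta>m / (2 * d) * d" using d0 by (intro mult_right_mono) (auto simp: s_def)
    then show "s * d < \<delta>m" using d0 \<delta>m by simp
  qed (simp add: s_def)
  have s1: "s < 1" using s(2) r0 d0 by (smt (verit) divide_pos_pos)
  let ?y = "\<lambda>s. p + s *\<^sub>R \<nu>"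
  have yx0: "norm (?y u - x0) = (1 - u) * d" if "u \<le> 1" for u
  proof -
    have "?y u - x0 = - ((1 - u) *\<^sub>R \<nu>)" by (simp add: \<nu>_def algebra_simps)
    then show ?thesis using that n\<nu> by simp
  qed
  have y\<Omega>: "?y u \<in> \<Omega>" if "0 < u" "u \<le> s" for u
  proof -
    have "(1 - u) * d < 1 * d" using that d0 by (intro mult_strict_right_mono) auto
    then have "norm (?y u - x0) < d" using yx0[of u] that s1 by simp
    then show ?thesis using ball_d by (metis dist_commute dist_norm mem_ball subsetD)
  qed
  have ycl: "?y u \<in> closure \<Omega>" if "0 \<le> u" "u \<le> s" for u
    using y\<Omega>[of u] that pf closure_subset[of \<Omega>] by (cases "u = 0") (auto simp: frontier_def)
  have t1T: "t1 \<in> {0..T}" using t1 \<tau> by simp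
  \<comment> \<open>Differentiability holds only inside \<Omega>, so the mean value theorem is used
    with continuity at the boundary end \<open>u = 0\<close> and derivatives for
    \<open>u > 0\<close>.\<close>
  have "continuous_on {0..s} (\<lambda>u. e (?y u) t1)"
    using continuous_on_compose2[OF c, of "{0..s}" "\<lambda>u. (?y u, t1)"] ycl t1T
    by (simp add: subset_iff image_iff continuous_intros) (metis atLeastAtMost_iff)
  moreover have der: "((\<lambda>u. e (?y u) t1) has_real_derivative (\<Sum>j\<in>UNIV. \<nu> $ j * pdx j e (?y u) t1)) (at u)"
    if "0 < u" "u < s" for u
    using C21_line(1)[OF e \<Omega>(2) t1T, of p u \<nu>] y\<Omega>[of u] that by simp
  ultimately obtain l z where z: "0 < z" "z < s" "DERIV (\<lambda>u. e (?y u) t1) z :> l"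
      "e (?y s) t1 - e (?y 0) t1 = (s - 0) * l"
    using MVT[of 0 s "\<lambda>u. e (?y u) t1"] s(1) real_differentiable_def by blast
  have l: "l = (\<Sum>j\<in>UNIV. \<nu> $ j * pdx j e (?y z) t1)"
    using DERIV_unique[OF z(3) der[OF z(1,2)]] .
  have "\<bar>l\<bar> \<le> (\<Sum>j\<in>(UNIV :: 'n set). d * \<alpha>)"
    unfolding l
  proof (rule order_trans[OF sum_abs], rule sum_mono)
    fix j
    have "dist (?y z) p = z * d" using z n\<nu> by (simp add: dist_norm)
    also have "\<dots> \<le> s * d" using z d0 by simp
    also have "\<dots> < \<delta>i j" using s(3) \<delta>m(2)[of j] by simp
    finally have "\<bar>pdx j e (?y z) t1\<bar> < \<alpha>" using \<delta>i(2) y\<Omega>[of z] z by auto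
    then show "\<bar>\<nu> $ j * pdx j e (?y z) t1\<bar> \<le> d * \<alpha>"
      unfolding abs_mult using component_le_norm_cart[of \<nu> j] n\<nu> by (intro mult_mono) auto
  qed
  also have "\<dots> = \<kappa> / 2" using d0 by (simp add: \<alpha>_def)
  finally have "l \<le> \<kappa> / 2" by simp
  moreover have "e (?y 0) t1 = 0" using bdry[OF pf t1] by simp
  ultimately have up: "e (?y s) t1 \<le> s * (\<kappa> / 2)"
    using z(4) s(1) by simp
  have "(?y s, t1) \<in> D"
  proof -
    have "r0 = r0 / d * d" using d0 by simp
    also have "\<dots> \<le> (1 - s) * d" using s(2) d0 by (intro mult_right_mono) auto
    finally have "r0 \<le> norm (?y s - x0)" using yx0[of s] s1 by simp
    moreover have "norm (?y s - x0) \<le> d" using yx0[of s] s1 s(1) d0 by (simp add: mult_le_cancel_right1)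
    ultimately show ?thesis using t1 qt1 by (simp add: D_def dist_norm norm_minus_commute)
  qed
  then have "barrier m K x0 r0 q (?y s) t1 \<le> e (?y s) t1" by (rule below)
  moreover have "s * \<kappa> \<le> barrier m K x0 r0 q (?y s) t1"
  proof -
    \<comment> \<open>Convexity of the exponential linearizes the barrier; then
      \<open>1 - (1 - s)\<^sup>2\<close> is at least \<open>s\<close> for \<open>s\<close> in the
      unit interval.\<close>
    have "1 + (K * d\<^sup>2 - K * ((1 - s) * d)\<^sup>2) \<le> exp (K * d\<^sup>2 - K * ((1 - s) * d)\<^sup>2)"
      by (rule exp_ge_add_one_self)
    moreover have "K * d\<^sup>2 * s \<le> K * d\<^sup>2 - K * ((1 - s) * d)\<^sup>2"
    proof -
      have "K * d\<^sup>2 - K * ((1 - s) * d)\<^sup>2 - K * d\<^sup>2 * s = K * d\<^sup>2 * (s * (1 - s))"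
        by (simp add: algebra_simps power2_eq_square)
      then show ?thesis using K s(1) s1 by (smt (verit) mult_nonneg_nonneg zero_le_power2)
    qed
    ultimately have "exp (- K * d\<^sup>2) * (K * d\<^sup>2 * s) \<le> exp (- K * d\<^sup>2) * (exp (K * d\<^sup>2 - K * ((1 - s) * d)\<^sup>2) - 1)"
      by (intro mult_left_mono; (linarith | simp))
    also have "\<dots> = exp (- K * ((1 - s) * d)\<^sup>2) - exp (- K * d\<^sup>2)"
      by (simp add: right_diff_distrib exp_add[symmetric])
    finally have "m * (exp (- K * d\<^sup>2) * (K * d\<^sup>2 * s)) \<le> m * (exp (- K * ((1 - s) * d)\<^sup>2) - exp (- K * d\<^sup>2))"
      using m by (intro mult_left_mono) auto
    moreover have "(?y s - x0) \<bullet> (?y s - x0) = ((1 - s) * d)\<^sup>2"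
      using yx0[of s] s1 by (simp add: power2_norm_eq_inner[symmetric])
    ultimately show ?thesis
      unfolding barrier_def qt1 \<kappa>_def by (simp add: algebra_simps)
  qed
  ultimately show False using up mult_pos_pos[OF s(1) \<kappa>] by linarith
qed

section \<open>The inverse matrix near the identity\<close>

lemma matrix_inv_both:
  fixes A :: "real^'n::finite^'n"
  assumes "det A \<noteq> 0"
  shows "A ** matrix_inv A = mat 1" "matrix_inv A ** A = mat 1"
proof -
  have "\<exists>A'. A ** A' = mat 1 \<and> A' ** A = mat 1"
    using assms invertible_det_nz unfolding invertible_def by blast
  then show "A ** matrix_inv A = mat 1" "matrix_inv A ** A = mat 1"
    unfolding matrix_inv_def by (metis (mono_tags, lifting) someI_ex)+
qed

text \<open>Column \<open>j\<close> of the inverse solves a linear system with a basis vector on the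
  right. The quotient of determinants makes the differentiability of the entries visible.\<close>

lemma matrix_inv_cramer:
  fixes A :: "real^'n::finite^'n"
  assumes "det A \<noteq> 0"
  shows "matrix_inv A $ i $ j = det (\<chi> a b. if b = i then axis j 1 $ a else A $ a $ b) / det A"
proof -
  have "A *v (matrix_inv A *v axis j 1) = axis j 1"
    by (simp add: matrix_vector_mul_assoc matrix_inv_both[OF assms])
  then have "matrix_inv A *v axis j 1 = (\<chi> k. det (\<chi> a b. if b = k then axis j 1 $ a else A $ a $ b) / det A)"
    using cramer[OF assms] by blast
  then show ?thesis
    by (simp add: matrix_vector_mult_basis column_def vec_eq_iff)
qed

lemma det_differentiable:
  fixes A :: "real \<Rightarrow> real^'n::finite^'n"
  assumes "\<And>i j. (\<lambda>s. A s $ i $ j) differentiable (at z)"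
  shows "(\<lambda>s. det (A s)) differentiable (at z)"
proof -
  obtain A' where A': "\<And>i j. ((\<lambda>s. A s $ i $ j) has_real_derivative A' i j) (at z)"
    using assms unfolding real_differentiable_def by metis
  have "(\<lambda>s. \<Prod>i\<in>UNIV. A s $ i $ p i) differentiable (at z)" for p
    using has_field_derivative_prod[of UNIV "\<lambda>i s. A s $ i $ p i" "\<lambda>i. A' i (p i)" z] A'
    unfolding real_differentiable_def by blast
  then show ?thesis
    unfolding det_def by (intro differentiable_sum differentiable_mult differentiable_const) auto
qed

text \<open>Cramer's rule only provides differentiability; the value of the derivative comes from
  differentiating \<open>A\<^sup>-\<^sup>1 A = 1\<close>, which keeps it bounded by the entries of \<open>A\<^sup>-\<^sup>1\<close> and \<open>P\<close>.\<close>
lemma matrix_inv_derivative: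
  fixes A :: "real \<Rightarrow> real^'n::finite^'n" and P :: "real^'n^'n"
  assumes A: "\<And>i j. ((\<lambda>s. A s $ i $ j) has_real_derivative P $ i $ j) (at z)"
    and det: "\<forall>\<^sub>F s in nhds z. det (A s) \<noteq> 0"
  shows "((\<lambda>s. matrix_inv (A s) $ i $ j) has_real_derivative
    - (\<Sum>a\<in>UNIV. \<Sum>b\<in>UNIV. matrix_inv (A z) $ i $ a * P $ a $ b * matrix_inv (A z) $ b $ j)) (at z)"
proof -
  have Ad: "(\<lambda>s. A s $ i $ j) differentiable (at z)" for i j
    using A real_differentiable_def by blast
  have det0: "det (A z) \<noteq> 0" using det by (rule eventually_nhds_x_imp_x)
  define B where "B i j = deriv (\<lambda>s. det (\<chi> a b. if b = i then axis j 1 $ a else A s $ a $ b) / det (A s)) z" for i j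
  have "(\<lambda>s. det (\<chi> a b. if b = i then axis j 1 $ a else A s $ a $ b) / det (A s)) differentiable (at z)" for i j
  proof (intro differentiable_divide det_differentiable Ad det0)
    show "(\<lambda>s. (\<chi> a b. if b = i then axis j 1 $ a else A s $ a $ b) $ i' $ j') differentiable (at z)" for i' j'
      using Ad by (cases "j' = i") auto
  qed
  then have B: "((\<lambda>s. det (\<chi> a b. if b = i then axis j 1 $ a else A s $ a $ b) / det (A s))
      has_real_derivative B i j) (at z)" for i j
    unfolding B_def DERIV_deriv_iff_real_differentiable .
  have ev: "\<forall>\<^sub>F s in nhds z. matrix_inv (A s) $ i $ j
      = det (\<chi> a b. if b = i then axis j 1 $ a else A s $ a $ b) / det (A s)" for i j
    using det by eventually_elim (rule matrix_inv_cramer)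
  have B: "((\<lambda>s. matrix_inv (A s) $ i $ j) has_real_derivative B i j) (at z)" for i j
    using B[of i j] DERIV_cong_ev[OF refl ev[of i j] refl] by simp
  \<comment> \<open>Differentiating the identity, valid near \<open>z\<close> where the determinant
    is nonzero, gives a linear equation for the derivative; it is solved below by multiplying with
    the inverse from the right.\<close>
  have id: "(\<Sum>b\<in>UNIV. B i b * A z $ b $ k + P $ b $ k * matrix_inv (A z) $ i $ b) = 0" for i k
  proof -
    have "((\<lambda>s. \<Sum>b\<in>UNIV. matrix_inv (A s) $ i $ b * A s $ b $ k) has_real_derivative
        (\<Sum>b\<in>UNIV. B i b * A z $ b $ k + P $ b $ k * matrix_inv (A z) $ i $ b)) (at z)"
      by (intro DERIV_sum DERIV_mult A B)
    moreover have ev1: "\<forall>\<^sub>F s in nhds z. (\<Sum>b\<in>UNIV. matrix_inv (A s) $ i $ b * A s $ b $ k) = mat 1 $ i $ k"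
      using det
    proof eventually_elim
      case (elim s)
      have "(matrix_inv (A s) ** A s) $ i $ k = mat 1 $ i $ k"
        using matrix_inv_both(2)[OF elim] by simp
      then show ?case by (simp add: matrix_matrix_mult_def)
    qed
    ultimately have "((\<lambda>s. mat 1 $ i $ k :: real) has_real_derivative
        (\<Sum>b\<in>UNIV. B i b * A z $ b $ k + P $ b $ k * matrix_inv (A z) $ i $ b)) (at z)"
      using DERIV_cong_ev[OF refl ev1 refl] by simp
    then show ?thesis using DERIV_const DERIV_unique by blast
  qed
  define Bm where "Bm = (\<chi> i j. B i j)"
  have "Bm ** A z = matrix_inv (A z) ** - P"
    using id by (simp add: vec_eq_iff matrix_matrix_mult_def Bm_def sum.distrib sum_negf mult.commute eq_neg_iff_add_eq_0)
  then have "Bm ** (A z ** matrix_inv (A z)) = matrix_inv (A z) ** - P ** matrix_inv (A z)"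
    by (metis matrix_mul_assoc)
  then have "B i j = (matrix_inv (A z) ** - P ** matrix_inv (A z)) $ i $ j"
    unfolding matrix_inv_both[OF det0] matrix_mul_rid by (auto simp: Bm_def dest: arg_cong[of _ _ "\<lambda>M. M $ i $ j"])
  also have "\<dots> = - (\<Sum>b\<in>UNIV. \<Sum>a\<in>UNIV. matrix_inv (A z) $ i $ a * P $ a $ b * matrix_inv (A z) $ b $ j)"
    by (simp add: matrix_matrix_mult_def sum_distrib_right sum_negf)
  also have "\<dots> = - (\<Sum>a\<in>UNIV. \<Sum>b\<in>UNIV. matrix_inv (A z) $ i $ a * P $ a $ b * matrix_inv (A z) $ b $ j)"
    by (subst sum.swap) (rule refl)
  finally show ?thesis using B[of i j] by simp
qed

text \<open>Entrywise closeness makes the perturbation of the identity have operator norm at most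
  1/2, so lengths change by factors between 1/2 and 3/2; the determinant is handled by
  continuity.\<close>

lemma matrix_near_identity:
  "\<exists>\<delta>>0. \<forall>A :: real^'n::finite^'n. (\<forall>i j. \<bar>A $ i $ j - mat 1 $ i $ j\<bar> < \<delta>) \<longrightarrow>
     1/2 < det A \<and> det A < 2 \<and> (\<forall>y. norm (A *v y) \<le> 2 * norm y) \<and> (\<forall>y. norm y \<le> 2 * norm (A *v y))"
proof -
  let ?n = "real CARD('n)"
  have "continuous_on UNIV (\<lambda>A :: real^'n^'n. det A)"
    unfolding det_def by (intro continuous_intros)
  then have "\<forall>e>0. \<exists>d>0. \<forall>A :: real^'n^'n. dist A (mat 1) < d \<longrightarrow> dist (det A) (det (mat 1 :: real^'n^'n)) < e"
    unfolding continuous_on_iff by blast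
  then obtain \<epsilon> where \<epsilon>: "\<epsilon> > 0" "\<And>A :: real^'n^'n. dist A (mat 1) < \<epsilon> \<Longrightarrow> \<bar>det A - 1\<bar> < 1/2"
    by (metis det_I dist_real_def half_gt_zero_iff zero_less_one)
  have n: "?n > 0" by simp
  \<comment> \<open>The \<open>n\<^sup>2\<close> entries together then contribute strictly less than
    both \<epsilon> and 1/2; the summand 1 gives the strictness.\<close>
  define \<delta> where "\<delta> = min \<epsilon> (1/2) / (?n * ?n + 1)"
  have nn: "?n * ?n + 1 > 0" by (simp add: add_pos_nonneg)
  have \<delta>: "\<delta> > 0" using \<epsilon> nn by (simp add: \<delta>_def)
  have \<delta>n: "?n * ?n * \<delta> < min \<epsilon> (1/2)"
  proof -
    have "?n * ?n * \<delta> < (?n * ?n + 1) * \<delta>" using \<delta> by simp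
    also have "\<dots> = min \<epsilon> (1/2)" using nn by (simp add: \<delta>_def)
    finally show ?thesis .
  qed
  have main: "1/2 < det A \<and> det A < 2 \<and> (\<forall>y. norm (A *v y) \<le> 2 * norm y) \<and> (\<forall>y. norm y \<le> 2 * norm (A *v y))"
    if A: "\<forall>i j. \<bar>A $ i $ j - mat 1 $ i $ j\<bar> < \<delta>" for A :: "real^'n^'n"
  proof -
    have c: "\<bar>(A - mat 1) $ i $ j\<bar> \<le> \<delta>" for i j using A by (simp add: less_imp_le)
    have "norm (A - mat 1) \<le> (\<Sum>i\<in>UNIV. norm ((A - mat 1) $ i))"
      unfolding norm_vec_def[of "A - mat 1"] by (intro L2_set_le_sum) auto
    also have "\<dots> \<le> (\<Sum>i\<in>(UNIV::'n set). \<Sum>j\<in>(UNIV::'n set). \<delta>)"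
      by (intro sum_mono order_trans[OF norm_le_l1_cart] c)
    also have "\<dots> = ?n * ?n * \<delta>" by simp
    finally have "dist A (mat 1) < \<epsilon>" using \<delta>n by (simp add: dist_norm)
    then have d: "\<bar>det A - 1\<bar> < 1/2" by (rule \<epsilon>(2))
    have y: "norm ((A - mat 1) *v y) \<le> 1/2 * norm y" for y
    proof -
      have "norm ((A - mat 1) *v y) \<le> onorm ((*v) (A - mat 1)) * norm y"
        by (rule onorm) (rule matrix_vector_mul_bounded_linear)
      also have "\<dots> \<le> (?n * ?n * \<delta>) * norm y"
        by (intro mult_right_mono onorm_le_matrix_component c) auto
      also have "\<dots> \<le> 1/2 * norm y" using \<delta>n by (intro mult_right_mono) auto
      finally show ?thesis .
    qed
    have "norm (A *v y) \<le> 2 * norm y \<and> norm y \<le> 2 * norm (A *v y)" for y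
    proof -
      have "A *v y = y + (A - mat 1) *v y" by (simp add: matrix_vector_mult_diff_rdistrib)
      then have "norm (A *v y) \<le> norm y + 1/2 * norm y" "norm y - 1/2 * norm y \<le> norm (A *v y)"
        using y[of y] norm_triangle_ineq[of y "(A - mat 1) *v y"]
          norm_diff_ineq[of y "(A - mat 1) *v y"] by simp_all
      then show ?thesis by simp
    qed
    then show ?thesis using d by (auto simp: abs_if split: if_splits)
  qed
  show ?thesis using \<delta> main by blast
qed

text \<open>Column \<open>l\<close> of the inverse is the preimage of a unit vector, so the lower
  bound on \<open>A\<close> controls it. Ellipticity follows by moving the inverse to the other side
  of the inner product, \<open>y \<bullet> y = z \<bullet> (A *v y)\<close>, where the entries of
  \<open>z\<close> are the products of \<open>y\<close> with the columns.\<close>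

lemma matrix_inv_bounds:
  fixes A :: "real^'n::finite^'n"
  assumes det: "det A \<noteq> 0" and up: "\<And>y. norm (A *v y) \<le> 2 * norm y" and lo: "\<And>y. norm y \<le> 2 * norm (A *v y)"
  shows "norm (column l (matrix_inv A)) \<le> 2" and "\<bar>matrix_inv A $ k $ l\<bar> \<le> 2"
    and "(norm y)\<^sup>2 \<le> 4 * (\<Sum>l\<in>UNIV. (y \<bullet> column l (matrix_inv A))\<^sup>2)"
proof -
  have Ac: "A *v column l (matrix_inv A) = axis l 1" for l
    by (simp add: matrix_vector_mult_basis[symmetric] matrix_vector_mul_assoc matrix_inv_both[OF det])
  show n2: "norm (column l (matrix_inv A)) \<le> 2"
    using lo[of "column l (matrix_inv A)"] unfolding Ac by simp
  show "\<bar>matrix_inv A $ k $ l\<bar> \<le> 2"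
    using component_le_norm_cart[of "column l (matrix_inv A)" k] n2 by (simp add: column_def)
  define z where "z = transpose (matrix_inv A) *v y"
  have z: "z $ l = y \<bullet> column l (matrix_inv A)" for l
    by (simp add: z_def matrix_vector_mult_def transpose_def column_def inner_vec_def mult.commute)
  have nz: "(\<Sum>l\<in>UNIV. (y \<bullet> column l (matrix_inv A))\<^sup>2) = (norm z)\<^sup>2"
    unfolding z[symmetric] power2_norm_eq_inner by (simp add: inner_vec_def power2_eq_square)
  have "(norm y)\<^sup>2 = y \<bullet> (matrix_inv A *v (A *v y))"
    by (simp add: power2_norm_eq_inner matrix_vector_mul_assoc matrix_inv_both[OF det])
  also have "\<dots> = z \<bullet> (A *v y)"
    by (simp add: z_def dot_lmul_matrix[symmetric] transpose_matrix_vector)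
  also have "\<dots> \<le> norm z * (2 * norm y)"
    using norm_cauchy_schwarz[of z "A *v y"] up[of y] by (meson mult_left_mono norm_ge_zero order_trans)
  finally have "norm y * norm y \<le> (2 * norm z) * norm y"
    by (simp add: power2_eq_square mult_ac)
  then have "norm y \<le> 2 * norm z"
    by (cases "y = 0") auto
  then have "(norm y)\<^sup>2 \<le> (2 * norm z)\<^sup>2" by (intro power_mono) auto
  then show "(norm y)\<^sup>2 \<le> 4 * (\<Sum>l\<in>UNIV. (y \<bullet> column l (matrix_inv A))\<^sup>2)"
    unfolding nz by (simp add: power_mult_distrib)
qed

section \<open>Uniform estimates from compactness of the closed cylinder\<close>

lemma cont_ext_bounded:
  assumes "bounded \<Omega>" "cont_ext \<Omega> T G"
  shows "\<exists>C. \<forall>x\<in>\<Omega>. \<forall>t\<in>{0..T}. \<bar>G x t\<bar> \<le> C"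
proof -
  obtain H where H: "continuous_on (closure \<Omega> \<times> {0..T}) H" "\<And>x t. x \<in> \<Omega> \<Longrightarrow> t \<in> {0..T} \<Longrightarrow> H (x, t) = G x t"
    using assms unfolding cont_ext_def by blast
  have "compact (closure \<Omega> \<times> {0..T})" using assms by (intro compact_Times) auto
  from compact_imp_bounded[OF compact_continuous_image[OF H(1) this]]
  obtain C where "\<And>z. z \<in> closure \<Omega> \<times> {0..T} \<Longrightarrow> \<bar>H z\<bar> \<le> C" by (auto simp: bounded_real)
  then show ?thesis using H(2) closure_subset[of \<Omega>] by (metis SigmaI subsetD)
qed

text \<open>Uniform continuity of the extension makes the time of closeness independent of
  \<open>x\<close>. It is meant for the entries of \<open>D\<eta>\<close>, which start from those of
  the identity.\<close>

lemma cont_ext_short_time: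
  assumes "bounded \<Omega>" "cont_ext \<Omega> T G" "T > 0" "\<delta> > 0" and G0: "\<And>x. x \<in> \<Omega> \<Longrightarrow> G x 0 = c"
  shows "\<exists>\<tau>>0. \<forall>x\<in>\<Omega>. \<forall>t\<in>{0..T}. t < \<tau> \<longrightarrow> \<bar>G x t - c\<bar> < \<delta>"
proof -
  obtain H where H: "continuous_on (closure \<Omega> \<times> {0..T}) H" "\<And>x t. x \<in> \<Omega> \<Longrightarrow> t \<in> {0..T} \<Longrightarrow> H (x, t) = G x t"
    using assms unfolding cont_ext_def by blast
  have "compact (closure \<Omega> \<times> {0..T})" using assms by (intro compact_Times) auto
  from compact_uniformly_continuous[OF H(1) this] \<open>\<delta> > 0\<close>
  obtain \<tau> where \<tau>: "\<tau> > 0" "\<And>z z'. z \<in> closure \<Omega> \<times> {0..T} \<Longrightarrow> z' \<in> closure \<Omega> \<times> {0..T} \<Longrightarrow>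
      dist z' z < \<tau> \<Longrightarrow> dist (H z') (H z) < \<delta>"
    unfolding uniformly_continuous_on_def by blast
  have "\<bar>G x t - c\<bar> < \<delta>" if "x \<in> \<Omega>" "t \<in> {0..T}" "t < \<tau>" for x t
  proof -
    have "dist (H (x, t)) (H (x, 0)) < \<delta>"
      using that closure_subset[of \<Omega>] \<open>T > 0\<close> by (intro \<tau>(2)) (auto simp: dist_Pair_Pair)
    then show ?thesis using H(2)[of x] G0 that \<open>T > 0\<close> by (simp add: dist_real_def)
  qed
  then show ?thesis using \<tau>(1) by blast
qed

lemma uniform_bound_finite:
  fixes G :: "'i::finite \<Rightarrow> 'a \<Rightarrow> real"
  assumes "\<And>i. \<exists>C. \<forall>z\<in>S. G i z \<le> C"
  shows "\<exists>C. \<forall>i. \<forall>z\<in>S. G i z \<le> C"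
proof -
  obtain C where C: "\<And>i z. z \<in> S \<Longrightarrow> G i z \<le> C i" using assms by metis
  have "G i z \<le> Max (range C)" if "z \<in> S" for i z
    using C[OF that, of i] by (rule order_trans) simp
  then show ?thesis by blast
qed

section \<open>Expanding the energy equation\<close>

text \<open>The diagonal of the symmetrized gradient alone contributes \<open>4 * S\<close>, and
  Cauchy-Schwarz bounds the squared trace by \<open>n * S\<close>. For negative \<open>lam\<close>
  the expression is therefore at least \<open>J\<close> times
  \<open>(2 * \<mu> + n * lam) * S\<close>.\<close>

lemma viscous_dissipation_nonneg:
  fixes M :: "'n::finite \<Rightarrow> 'n \<Rightarrow> real"
  assumes "\<mu> > 0" "2 * \<mu> + real CARD('n) * lam \<ge> 0" "J \<ge> 0"
  shows "0 \<le> \<mu> / 2 * J * (\<Sum>i\<in>UNIV. \<Sum>l\<in>UNIV. (M i l + M l i)\<^sup>2) + lam * J * (\<Sum>i\<in>UNIV. M i i)\<^sup>2"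
proof -
  define S where "S = (\<Sum>i\<in>UNIV. (M i i)\<^sup>2)"
  define D where "D = (\<Sum>i\<in>UNIV. \<Sum>l\<in>UNIV. (M i l + M l i)\<^sup>2)"
  define tr where "tr = (\<Sum>i\<in>UNIV. M i i)"
  have S: "S \<ge> 0" unfolding S_def by (intro sum_nonneg) auto
  have "4 * S = (\<Sum>i\<in>UNIV. (M i i + M i i)\<^sup>2)"
    unfolding S_def sum_distrib_left by (intro sum.cong) (auto simp: power2_eq_square)
  also have "\<dots> \<le> D" unfolding D_def
    by (intro sum_mono member_le_sum[where f="\<lambda>l. (M _ l + M l _)\<^sup>2"]) auto
  finally have D: "4 * S \<le> D" .
  have tr: "tr\<^sup>2 \<le> real CARD('n) * S"
    using Cauchy_Schwarz_ineq_sum[of "\<lambda>i. M i i" "\<lambda>_. 1" UNIV] by (simp add: tr_def S_def mult.commute)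
  have "0 \<le> \<mu> / 2 * D + lam * tr\<^sup>2"
  proof (cases "lam \<ge> 0")
    case True
    have "D \<ge> 0" using D S by simp
    then show ?thesis using True assms(1) by (intro add_nonneg_nonneg mult_nonneg_nonneg) auto
  next
    case False
    have "0 \<le> (2 * \<mu> + real CARD('n) * lam) * S" using assms S by simp
    also have "\<dots> = \<mu> / 2 * (4 * S) + lam * (real CARD('n) * S)" by (simp add: algebra_simps)
    also have "\<dots> \<le> \<mu> / 2 * D + lam * tr\<^sup>2"
      using False assms(1) D tr by (intro add_mono mult_left_mono mult_left_mono_neg) auto
    finally show ?thesis .
  qed
  then have "0 \<le> J * (\<mu> / 2 * D + lam * tr\<^sup>2)" using assms(3) by simp
  also have "\<dots> = \<mu> / 2 * J * D + lam * J * tr\<^sup>2" by (simp add: algebra_simps)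
  finally show ?thesis by (simp only: D_def tr_def)
qed

lemma hess_scaleR: "hess F x t (a *\<^sub>R \<xi>) = a\<^sup>2 * hess F x t \<xi>"
  unfolding hess_def by (simp add: sum_distrib_left power2_eq_square mult_ac)

text \<open>Because \<open>b = J B\<close>, the inner factor \<open>J\<^sup>-\<^sup>1\<close>
  cancels and the operator is \<open>J B \<nabla> \<cdot> (B \<nabla>e)\<close> in nondivergence
  form. The product rule differentiates \<open>B\<close> and the gradient but never
  \<open>J\<close>; the negative double sum is the derivative of \<open>B\<close>.\<close>

lemma piola_laplacian_expand:
  fixes e :: "real^'n::finite \<Rightarrow> real \<Rightarrow> real" and \<eta> :: "real^'n \<Rightarrow> real \<Rightarrow> real^'n"
  assumes \<Omega>: "open \<Omega>" "x \<in> \<Omega>" and t: "t \<in> {0..T}"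
    and e: "C21 \<Omega> T e" and \<eta>: "\<And>i. C21 \<Omega> T (comp \<eta> i)"
    and J: "\<And>y. y \<in> \<Omega> \<Longrightarrow> Jac \<eta> y t \<noteq> 0"
  defines "B \<equiv> matrix_inv (Deta \<eta> x t)"
  shows "(\<Sum>l\<in>UNIV. \<Sum>k\<in>UNIV. bm \<eta> l k x t *
            pdx k (\<lambda>y s. inverse (Jac \<eta> y s) * (\<Sum>j\<in>UNIV. bm \<eta> l j y s * pdx j e y s)) x t)
       = Jac \<eta> x t * (\<Sum>l\<in>UNIV. hess e x t (column l B))
         + (\<Sum>j\<in>UNIV. (\<Sum>l\<in>UNIV. \<Sum>k\<in>UNIV. Jac \<eta> x t * B $ k $ l *
              - (\<Sum>a\<in>UNIV. \<Sum>b\<in>UNIV. B $ j $ a * pdx k (pdx b (comp \<eta> a)) x t * B $ b $ l)) * pdx j e x t)"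
proof -
  define B' where "B' k j l = - (\<Sum>a\<in>UNIV. \<Sum>b\<in>UNIV. B $ j $ a * pdx k (pdx b (comp \<eta> a)) x t * B $ b $ l)" for k j l
  have flux: "pdx k (\<lambda>y s. inverse (Jac \<eta> y s) * (\<Sum>j\<in>UNIV. bm \<eta> l j y s * pdx j e y s)) x t
      = (\<Sum>j\<in>UNIV. B' k j l * pdx j e x t + pdx k (pdx j e) x t * B $ j $ l)" for k l
  proof -
    define y where "y s = x + s *\<^sub>R axis k 1" for s
    have "continuous_on UNIV y" unfolding y_def by (intro continuous_intros)
    then have "open (y -` \<Omega>)" using \<Omega>(1) continuous_on_open_vimage[of UNIV y] by simp
    then have "\<forall>\<^sub>F s in nhds 0. s \<in> y -` \<Omega>"
      by (rule eventually_nhds_in_open) (simp add: y_def \<Omega>)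
    then have ev: "\<forall>\<^sub>F s in nhds 0. y s \<in> \<Omega>" by simp
    have y0: "y 0 = x" by (simp add: y_def)
    have A: "((\<lambda>s. Deta \<eta> (y s) t $ i $ j) has_real_derivative
        (\<chi> i j. pdx k (pdx j (comp \<eta> i)) x t) $ i $ j) (at 0)" for i j
      using C21_pdx(2)[OF \<eta> t \<Omega>(2)] by (simp add: Deta_def y_def)
    have det: "\<forall>\<^sub>F s in nhds 0. det (Deta \<eta> (y s) t) \<noteq> 0"
      using ev by eventually_elim (use J in \<open>simp add: Jac_def\<close>)
    have dB: "((\<lambda>s. matrix_inv (Deta \<eta> (y s) t) $ j $ l) has_real_derivative B' k j l) (at 0)" for j
      using matrix_inv_derivative[OF A det, of j l] by (simp add: B'_def B_def y0)
    have dE: "((\<lambda>s. pdx j e (y s) t) has_real_derivative pdx k (pdx j e) x t) (at 0)" for j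
      using C21_pdx(2)[OF e t \<Omega>(2)] by (simp add: y_def)
    have "((\<lambda>s. matrix_inv (Deta \<eta> (y s) t) $ j $ l * pdx j e (y s) t) has_real_derivative
        B' k j l * pdx j e x t + pdx k (pdx j e) x t * B $ j $ l) (at 0)" for j
      using DERIV_mult[OF dB[of j] dE[of j]] by (simp add: y0 B_def)
    then have "((\<lambda>s. \<Sum>j\<in>UNIV. matrix_inv (Deta \<eta> (y s) t) $ j $ l * pdx j e (y s) t) has_real_derivative
        (\<Sum>j\<in>UNIV. B' k j l * pdx j e x t + pdx k (pdx j e) x t * B $ j $ l)) (at 0)"
      by (intro DERIV_sum)
    \<comment> \<open>The cancellation of \<open>J\<close> is valid wherever it is nonzero, in
      particular on a neighbourhood of the base point, which suffices for the derivative.\<close>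
    moreover have ev2: "\<forall>\<^sub>F s in nhds 0. inverse (Jac \<eta> (y s) t) * (\<Sum>j\<in>UNIV. bm \<eta> l j (y s) t * pdx j e (y s) t)
        = (\<Sum>j\<in>UNIV. matrix_inv (Deta \<eta> (y s) t) $ j $ l * pdx j e (y s) t)"
      using ev
    proof eventually_elim
      case (elim s)
      show ?case using J[OF elim] by (simp add: sum_distrib_left bm_def Bm_def field_simps)
    qed
    ultimately have "((\<lambda>s. inverse (Jac \<eta> (y s) t) * (\<Sum>j\<in>UNIV. bm \<eta> l j (y s) t * pdx j e (y s) t)) has_real_derivative
        (\<Sum>j\<in>UNIV. B' k j l * pdx j e x t + pdx k (pdx j e) x t * B $ j $ l)) (at 0)"
      using DERIV_cong_ev[OF refl ev2 refl] by simp
    then show ?thesis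
      unfolding pdx_def[of k "\<lambda>y s. inverse (Jac \<eta> y s) * (\<Sum>j\<in>UNIV. bm \<eta> l j y s * pdx j e y s)"]
        y_def by (rule DERIV_imp_deriv)
  qed
  let ?J = "Jac \<eta> x t"
  have "(\<Sum>l\<in>UNIV. \<Sum>k\<in>UNIV. bm \<eta> l k x t *
            pdx k (\<lambda>y s. inverse (Jac \<eta> y s) * (\<Sum>j\<in>UNIV. bm \<eta> l j y s * pdx j e y s)) x t)
      = (\<Sum>l\<in>UNIV. \<Sum>k\<in>UNIV. bm \<eta> l k x t *
          (\<Sum>j\<in>UNIV. B' k j l * pdx j e x t + pdx k (pdx j e) x t * B $ j $ l))"
    by (simp only: flux)
  also have "\<dots> = (\<Sum>l\<in>UNIV. \<Sum>k\<in>UNIV. \<Sum>j\<in>UNIV. ?J * (B $ j $ l * B $ k $ l * pdx k (pdx j e) x t))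
        + (\<Sum>l\<in>UNIV. \<Sum>k\<in>UNIV. \<Sum>j\<in>UNIV. ?J * B $ k $ l * B' k j l * pdx j e x t)"
    unfolding bm_def Bm_def B_def[symmetric] sum.distrib[symmetric] sum_distrib_left
    by (intro sum.cong refl) (simp add: algebra_simps)
  also have "(\<Sum>l\<in>UNIV. \<Sum>k\<in>UNIV. \<Sum>j\<in>UNIV. ?J * (B $ j $ l * B $ k $ l * pdx k (pdx j e) x t))
      = ?J * (\<Sum>l\<in>UNIV. hess e x t (column l B))"
    unfolding hess_def sum_distrib_left column_def vec_lambda_beta
    by (rule sum.cong[OF refl], rule sum.swap)
  also have "(\<Sum>l\<in>UNIV. \<Sum>k\<in>UNIV. \<Sum>j\<in>UNIV. ?J * B $ k $ l * B' k j l * pdx j e x t)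
      = (\<Sum>l\<in>UNIV. \<Sum>j\<in>UNIV. \<Sum>k\<in>UNIV. ?J * B $ k $ l * B' k j l * pdx j e x t)"
    by (intro sum.cong refl sum.swap)
  also have "\<dots> = (\<Sum>j\<in>UNIV. \<Sum>l\<in>UNIV. \<Sum>k\<in>UNIV. ?J * B $ k $ l * B' k j l * pdx j e x t)"
    by (rule sum.swap)
  also have "\<dots> = (\<Sum>j\<in>UNIV. (\<Sum>l\<in>UNIV. \<Sum>k\<in>UNIV. ?J * B $ k $ l * B' k j l) * pdx j e x t)"
    by (simp add: sum_distrib_right)
  finally show ?thesis unfolding B'_def .
qed

lemma abs_double_sum_le:
  fixes f :: "'n::finite \<Rightarrow> 'n \<Rightarrow> real"
  assumes "\<And>i j. \<bar>f i j\<bar> \<le> K"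
  shows "\<bar>\<Sum>i\<in>UNIV. \<Sum>j\<in>UNIV. f i j\<bar> \<le> real CARD('n) * real CARD('n) * K"
proof -
  have "\<bar>\<Sum>i\<in>UNIV. \<Sum>j\<in>UNIV. f i j\<bar> \<le> (\<Sum>i\<in>UNIV. \<Sum>j\<in>UNIV. \<bar>f i j\<bar>)"
    by (rule order_trans[OF sum_abs sum_mono[OF sum_abs]])
  also have "\<dots> \<le> (\<Sum>i\<in>(UNIV::'n set). \<Sum>j\<in>(UNIV::'n set). K)"
    by (intro sum_mono assms)
  finally show ?thesis by simp
qed

text \<open>The pressure work becomes the zero-order coefficient, derivatives of \<open>B\<close>
  form the drift, and scaled columns of \<open>B\<close> are the diffusion directions. On a short
  time interval closeness of \<open>D\<eta>\<close> to the identity bounds all of them; discarding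
  the dissipation yields the inequality.\<close>

lemma energy_supersolution:
  fixes e :: "real^'n::finite \<Rightarrow> real \<Rightarrow> real" and v \<eta> :: "real^'n \<Rightarrow> real \<Rightarrow> real^'n"
  assumes \<Omega>: "bounded \<Omega>" "open \<Omega>" and T: "T > 0"
    and par: "\<mu> > 0" "2 * \<mu> + real CARD('n) * lam \<ge> 0" "\<kappa> > 0" "\<gamma> > 1" "R > 0"
    and v: "\<And>i. C21 \<Omega> T (comp v i)" and e: "C21 \<Omega> T e" and \<eta>: "\<And>i. C21 \<Omega> T (comp \<eta> i)"
    and J: "\<And>x t. x \<in> \<Omega> \<Longrightarrow> t \<in> {0<..T} \<Longrightarrow> Jac \<eta> x t \<noteq> 0"
    and energy: "\<And>x t. x \<in> \<Omega> \<Longrightarrow> t \<in> {0<..T} \<Longrightarrow> energy_eq \<mu> lam \<kappa> \<gamma> R T \<rho>0 v e \<eta> x t"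
    and init: "\<And>x. x \<in> \<Omega> \<Longrightarrow> \<eta> x 0 = x"
  shows "\<exists>\<tau> C \<theta>. 0 < \<tau> \<and> \<tau> \<le> T \<and> 0 \<le> C \<and> 0 < \<theta> \<and> supersolution \<Omega> T \<tau> \<rho>0 C \<theta> e"
proof -
  let ?n = "real CARD('n)"
  obtain \<delta> where \<delta>: "\<delta> > 0" and nearI: "\<And>A :: real^'n^'n. (\<And>i j. \<bar>A $ i $ j - mat 1 $ i $ j\<bar> < \<delta>) \<Longrightarrow>
     1/2 < det A \<and> det A < 2 \<and> (\<forall>y. norm (A *v y) \<le> 2 * norm y) \<and> (\<forall>y. norm y \<le> 2 * norm (A *v y))"
    using matrix_near_identity[where 'n='n] by blast
  have D0: "pdx j (comp \<eta> i) x 0 = mat 1 $ i $ j" if x: "x \<in> \<Omega>" for i j x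
  proof -
    have "continuous_on UNIV (\<lambda>s. x + s *\<^sub>R axis j (1::real))" by (intro continuous_intros)
    then have "open ((\<lambda>s. x + s *\<^sub>R axis j (1::real)) -` \<Omega>)"
      using \<Omega>(2) continuous_on_open_vimage[of UNIV "\<lambda>s. x + s *\<^sub>R axis j (1::real)"] by simp
    then have "\<forall>\<^sub>F s in nhds 0. s \<in> (\<lambda>s. x + s *\<^sub>R axis j (1::real)) -` \<Omega>"
      by (rule eventually_nhds_in_open) (simp add: x)
    then have ev: "\<forall>\<^sub>F s in nhds 0. comp \<eta> i (x + s *\<^sub>R axis j 1) 0 = x $ i + s * axis j 1 $ i"
      by eventually_elim (simp add: comp_def init)
    have "((\<lambda>s. x $ i + s * axis j 1 $ i) has_real_derivative mat 1 $ i $ j) (at 0)"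
      by (auto intro!: derivative_eq_intros simp: axis_def mat_def)
    then have "((\<lambda>s. comp \<eta> i (x + s *\<^sub>R axis j 1) 0) has_real_derivative mat 1 $ i $ j) (at 0)"
      using DERIV_cong_ev[OF refl ev refl] by simp
    then show ?thesis unfolding pdx_def by (rule DERIV_imp_deriv)
  qed
  have ext: "cont_ext \<Omega> T (pdx j (comp w i))" "cont_ext \<Omega> T (pdx k (pdx j (comp w i)))"
    if "C21 \<Omega> T (comp w i)" for w i j k
    using that unfolding C21_def by auto
  have "\<forall>i j. \<exists>\<tau>>0. \<forall>x\<in>\<Omega>. \<forall>t\<in>{0..T}. t < \<tau> \<longrightarrow> \<bar>pdx j (comp \<eta> i) x t - mat 1 $ i $ j\<bar> < \<delta>"
    using cont_ext_short_time[OF \<Omega>(1) ext(1)[OF \<eta>] T \<delta> D0] by blast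
  then obtain \<tau>' where \<tau>': "\<And>i j. \<tau>' i j > 0"
    "\<And>i j x t. x \<in> \<Omega> \<Longrightarrow> t \<in> {0..T} \<Longrightarrow> t < \<tau>' i j \<Longrightarrow> \<bar>pdx j (comp \<eta> i) x t - mat 1 $ i $ j\<bar> < \<delta>"
    by metis
  define \<tau>0 where "\<tau>0 = Min (range (\<lambda>(i, j). \<tau>' i j))"
  have \<tau>0: "\<tau>0 > 0" "\<And>i j. \<tau>0 \<le> \<tau>' i j"
    using \<tau>'(1) by (auto simp: \<tau>0_def intro!: Min_le image_eqI[where x="(_, _)"])
  \<comment> \<open>Halving keeps the closed interval up to \<tau> strictly below the time at which
    closeness might be lost.\<close>
  define \<tau> where "\<tau> = min T (\<tau>0 / 2)"
  have \<tau>: "0 < \<tau>" "\<tau> \<le> T" "\<tau> < \<tau>0" using T \<tau>0(1) by (auto simp: \<tau>_def)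
  have near: "1/2 < Jac \<eta> x t \<and> Jac \<eta> x t < 2 \<and> (\<forall>y. norm (Deta \<eta> x t *v y) \<le> 2 * norm y) \<and>
      (\<forall>y. norm y \<le> 2 * norm (Deta \<eta> x t *v y))" if "x \<in> \<Omega>" "t \<in> {0<..\<tau>}" for x t
    unfolding Jac_def
  proof (rule nearI)
    fix i j
    have "t < \<tau>' i j" using that \<tau> \<tau>0(2)[of i j] by simp
    then show "\<bar>Deta \<eta> x t $ i $ j - mat 1 $ i $ j\<bar> < \<delta>"
      using \<tau>'(2)[of x t i j] that \<tau> by (simp add: Deta_def)
  qed
  have "\<exists>C. \<forall>i j. \<forall>(x, t)\<in>\<Omega> \<times> {0..T}. \<bar>pdx j (comp v i) x t\<bar> \<le> C"
  proof -
    have "\<exists>C. \<forall>z\<in>\<Omega> \<times> {0..T}. \<bar>pdx j (comp v i) (fst z) (snd z)\<bar> \<le> C" for i j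
      using cont_ext_bounded[OF \<Omega>(1) ext(1)[OF v]] by fastforce
    then have "\<exists>C. \<forall>p. \<forall>z\<in>\<Omega> \<times> {0..T}. \<bar>pdx (snd p) (comp v (fst p)) (fst z) (snd z)\<bar> \<le> C"
      by (intro uniform_bound_finite[where G="\<lambda>p z. \<bar>pdx (snd p) (comp v (fst p)) (fst z) (snd z)\<bar>"]) auto
    then show ?thesis by fastforce
  qed
  then obtain Cv where Cv: "\<And>i j x t. x \<in> \<Omega> \<Longrightarrow> t \<in> {0..T} \<Longrightarrow> \<bar>pdx j (comp v i) x t\<bar> \<le> Cv" by fastforce
  have "\<exists>C. \<forall>i j k. \<forall>(x, t)\<in>\<Omega> \<times> {0..T}. \<bar>pdx k (pdx j (comp \<eta> i)) x t\<bar> \<le> C"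
  proof -
    have "\<exists>C. \<forall>z\<in>\<Omega> \<times> {0..T}. \<bar>pdx k (pdx j (comp \<eta> i)) (fst z) (snd z)\<bar> \<le> C" for i j k
      using cont_ext_bounded[OF \<Omega>(1) ext(2)[OF \<eta>]] by fastforce
    then have "\<exists>C. \<forall>p. \<forall>z\<in>\<Omega> \<times> {0..T}. \<bar>pdx (snd (snd p)) (pdx (fst (snd p)) (comp \<eta> (fst p))) (fst z) (snd z)\<bar> \<le> C"
      by (intro uniform_bound_finite[where G="\<lambda>p z. \<bar>pdx (snd (snd p)) (pdx (fst (snd p)) (comp \<eta> (fst p))) (fst z) (snd z)\<bar>"]) auto
    then show ?thesis by fastforce
  qed
  then obtain C2 where C2: "\<And>i j k x t. x \<in> \<Omega> \<Longrightarrow> t \<in> {0..T} \<Longrightarrow> \<bar>pdx k (pdx j (comp \<eta> i)) x t\<bar> \<le> C2" by fastforce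
  define \<kappa>' where "\<kappa>' = \<kappa> * (\<gamma> - 1) / R"
  have \<kappa>': "\<kappa>' > 0" using par by (simp add: \<kappa>'_def)
  \<comment> \<open>The factors 2 are the bounds for \<open>J\<close> and for the entries of
    \<open>B\<close>. Absolute values make the constants nonnegative even if \<Omega> is empty and
    \<open>Cv\<close> or \<open>C2\<close> happens to be negative.\<close>
  define Cc where "Cc = \<bar>(\<gamma> - 1) * (?n * ?n * (2 * Cv))\<bar>"
  define C\<beta>1 where "C\<beta>1 = \<kappa>' * (?n * ?n * (4 * (?n * ?n * (4 * C2))))"
  define C\<beta> where "C\<beta> = \<bar>?n * C\<beta>1\<bar>"
  define C\<xi> where "C\<xi> = sqrt (\<kappa>' * 2) * 2"
  define C where "C = Cc + C\<beta> + C\<xi>"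
  have C0: "Cc \<ge> 0" "C\<beta> \<ge> 0" "C\<xi> \<ge> 0" using \<kappa>' by (simp_all add: Cc_def C\<beta>_def C\<xi>_def)
  \<comment> \<open>The ellipticity constant combines \<open>J > 1/2\<close> with the factor 4 from
    the bound on the inverse.\<close>
  have "supersolution \<Omega> T \<tau> \<rho>0 C (\<kappa>' / 8) e"
    unfolding supersolution_def
  proof (intro ballI)
    fix x t assume xt: "x \<in> \<Omega>" "t \<in> {0<..\<tau>}"
    have t: "t \<in> {0..T}" "t \<in> {0<..T}" using xt \<tau> by auto
    define Jx where "Jx = Jac \<eta> x t"
    define B where "B = matrix_inv (Deta \<eta> x t)"
    have Jx: "1/2 < Jx" "Jx < 2" using near[OF xt] by (auto simp: Jx_def)
    have det: "det (Deta \<eta> x t) \<noteq> 0" using Jx by (auto simp: Jx_def Jac_def)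
    note Bb = matrix_inv_bounds[OF det, folded B_def, OF conjunct1[OF conjunct2[OF conjunct2[OF near[OF xt]]], rule_format]
      conjunct2[OF conjunct2[OF conjunct2[OF near[OF xt]]], rule_format]]
    have C2x: "\<bar>pdx k (pdx j (comp \<eta> i)) x t\<bar> \<le> C2" for i j k using C2 xt t by blast
    define S where "S = (\<Sum>i\<in>UNIV. \<Sum>j\<in>UNIV. bm \<eta> i j x t * pdx j (comp v i) x t)"
    define c where "c = (\<gamma> - 1) * (inverse Jx * S)"
    define B' where "B' k j l = - (\<Sum>a\<in>UNIV. \<Sum>b\<in>UNIV. B $ j $ a * pdx k (pdx b (comp \<eta> a)) x t * B $ b $ l)" for k j l
    define \<beta> where "\<beta> = (\<chi> j. \<kappa>' * (\<Sum>l\<in>UNIV. \<Sum>k\<in>UNIV. Jx * B $ k $ l * B' k j l))"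
    \<comment> \<open>The Hessian form is quadratic, so the square root absorbs the factor
      \<open>\<kappa>' * Jx\<close> into the direction.\<close>
    define \<xi> where "\<xi> l = sqrt (\<kappa>' * Jx) *\<^sub>R column l B" for l
    have sq: "(sqrt (\<kappa>' * Jx))\<^sup>2 = \<kappa>' * Jx" using \<kappa>' Jx by simp
    have "inverse Jx * S = (\<Sum>i\<in>UNIV. \<Sum>j\<in>UNIV. B $ j $ i * pdx j (comp v i) x t)"
      unfolding S_def sum_distrib_left bm_def Bm_def B_def[symmetric] Jx_def[symmetric]
      using Jx by (intro sum.cong refl) (simp add: field_simps)
    also have "\<bar>\<dots>\<bar> \<le> ?n * ?n * (2 * Cv)"
      unfolding abs_mult using Bb(2) Cv xt t
      by (intro abs_double_sum_le) (auto simp: abs_mult intro!: mult_mono)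
    finally have "\<bar>c\<bar> \<le> (\<gamma> - 1) * (?n * ?n * (2 * Cv))"
      using par by (simp add: c_def abs_mult[of "\<gamma> - 1"] mult_left_mono del: abs_mult)
    then have c: "\<bar>c\<bar> \<le> C" unfolding C_def Cc_def using C0 by linarith
    have B'b: "\<bar>B' k j l\<bar> \<le> ?n * ?n * (4 * C2)" for k j l
    proof -
      have "\<bar>B $ j $ a * pdx k (pdx b (comp \<eta> a)) x t * B $ b $ l\<bar> \<le> 2 * C2 * 2" for a b
        unfolding abs_mult using Bb(2) C2x order_trans[OF abs_ge_zero C2x]
        by (intro mult_mono) auto
      then show ?thesis unfolding B'_def abs_minus_cancel by (intro abs_double_sum_le) simp
    qed
    have "norm \<beta> \<le> (\<Sum>j\<in>UNIV. \<bar>\<beta> $ j\<bar>)" by (rule norm_le_l1_cart)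
    also have "\<dots> \<le> (\<Sum>j\<in>(UNIV::'n set). C\<beta>1)"
    proof (rule sum_mono)
      fix j
      have "\<bar>Jx * B $ k $ l * B' k j l\<bar> \<le> 2 * 2 * (?n * ?n * (4 * C2))" for k l
        unfolding abs_mult using Bb(2) B'b[of k j l] Jx by (intro mult_mono) auto
      then have "\<bar>\<Sum>l\<in>UNIV. \<Sum>k\<in>UNIV. Jx * B $ k $ l * B' k j l\<bar> \<le> ?n * ?n * (4 * (?n * ?n * (4 * C2)))"
        by (intro abs_double_sum_le) simp
      then show "\<bar>\<beta> $ j\<bar> \<le> C\<beta>1"
        unfolding \<beta>_def C\<beta>1_def using \<kappa>' by (simp add: abs_mult del: abs_le_iff)
    qed
    finally have \<beta>: "norm \<beta> \<le> C" unfolding C_def C\<beta>_def using C0 by simp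
    have \<xi>: "norm (\<xi> l) \<le> C" for l
    proof -
      have "norm (\<xi> l) = sqrt (\<kappa>' * Jx) * norm (column l B)" using \<kappa>' Jx by (simp add: \<xi>_def)
      also have "\<dots> \<le> sqrt (\<kappa>' * 2) * 2" using Bb(1) \<kappa>' Jx by (intro mult_mono) auto
      finally show ?thesis using C0 unfolding C_def C\<xi>_def by simp
    qed
    have ell: "\<kappa>' / 8 * (norm y)\<^sup>2 \<le> (\<Sum>l\<in>UNIV. (y \<bullet> \<xi> l)\<^sup>2)" for y
    proof -
      have "(\<Sum>l\<in>UNIV. (y \<bullet> \<xi> l)\<^sup>2) = \<kappa>' * Jx * (\<Sum>l\<in>UNIV. (y \<bullet> column l B)\<^sup>2)"
        unfolding \<xi>_def by (simp add: power_mult_distrib sq sum_distrib_left)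
      moreover have "\<kappa>' / 8 * (norm y)\<^sup>2 \<le> \<kappa>' / 8 * (4 * (\<Sum>l\<in>UNIV. (y \<bullet> column l B)\<^sup>2))"
        using Bb(3)[of y] \<kappa>' by (intro mult_left_mono) auto
      moreover have "\<kappa>' / 8 * (4 * (\<Sum>l\<in>UNIV. (y \<bullet> column l B)\<^sup>2)) = \<kappa>' * (1/2) * (\<Sum>l\<in>UNIV. (y \<bullet> column l B)\<^sup>2)"
        by simp
      moreover have "\<kappa>' * (1/2) * (\<Sum>l\<in>UNIV. (y \<bullet> column l B)\<^sup>2) \<le> \<kappa>' * Jx * (\<Sum>l\<in>UNIV. (y \<bullet> column l B)\<^sup>2)"
        using Jx \<kappa>' by (intro mult_right_mono mult_left_mono sum_nonneg) auto
      ultimately show ?thesis by linarith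
    qed
    have coeffs: "ell_coeffs C (\<kappa>' / 8) c \<beta> \<xi>"
      unfolding ell_coeffs_def using c \<beta> \<xi> ell by blast
    define Df where "Df = Jx * (\<Sum>l\<in>UNIV. hess e x t (column l B))
         + (\<Sum>j\<in>UNIV. (\<Sum>l\<in>UNIV. \<Sum>k\<in>UNIV. Jx * B $ k $ l * B' k j l) * pdx j e x t)"
    define Qd where "Qd = \<mu> / 2 * inverse Jx *
          (\<Sum>i\<in>UNIV. \<Sum>l\<in>UNIV. (Mvel v \<eta> i l x t + Mvel v \<eta> l i x t)\<^sup>2)
      + lam * inverse Jx * S\<^sup>2"
    have "S = (\<Sum>i\<in>UNIV. Mvel v \<eta> i i x t)" by (simp add: S_def Mvel_def)
    then have Qd: "Qd \<ge> 0"
      unfolding Qd_def using viscous_dissipation_nonneg[OF par(1,2), of "inverse Jx" "\<lambda>i l. Mvel v \<eta> i l x t"] Jx by simp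
    have diffusion: "(\<Sum>l\<in>UNIV. \<Sum>k\<in>UNIV. bm \<eta> l k x t *
            pdx k (\<lambda>y s. inverse (Jac \<eta> y s) * (\<Sum>j\<in>UNIV. bm \<eta> l j y s * pdx j e y s)) x t) = Df"
      unfolding Df_def B'_def B_def Jx_def
      by (rule piola_laplacian_expand[OF \<Omega>(2) xt(1) t(1) e \<eta> J[OF _ t(2)]])
    \<comment> \<open>The energy equation with its terms named; the pressure term equals
      \<open>\<rho>0 * c * e\<close>, so it can move under the common factor
      \<open>\<rho>0\<close>.\<close>
    have en: "\<rho>0 x * pdt T e x t + (\<gamma> - 1) * inverse Jx * \<rho>0 x * e x t * S = Qd + \<kappa>' * Df"
      using energy[OF xt(1) t(2)]
      unfolding energy_eq_def diffusion by (simp only: Qd_def S_def Jx_def \<kappa>'_def)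
    have "(\<Sum>l\<in>UNIV. hess e x t (\<xi> l)) + (\<Sum>j\<in>UNIV. \<beta> $ j * pdx j e x t) = \<kappa>' * Df"
      unfolding Df_def \<xi>_def \<beta>_def hess_scaleR sq
      by (simp add: sum_distrib_left sum_distrib_right distrib_left mult.assoc)
    also have "\<dots> \<le> \<rho>0 x * (pdt T e x t + c * e x t)"
      using en Qd by (simp add: c_def algebra_simps)
    finally show "\<exists>c \<beta> \<xi>. ell_coeffs C (\<kappa>' / 8) c \<beta> \<xi> \<and>
        (\<Sum>l\<in>UNIV. hess e x t (\<xi> l)) + (\<Sum>j\<in>UNIV. \<beta> $ j * pdx j e x t) \<le> \<rho>0 x * (pdt T e x t + c * e x t)"
      using coeffs by blast
  qed
  then show ?thesis using \<tau> \<kappa>' C0 unfolding C_def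
    by (intro exI[of _ \<tau>] exI[of _ "Cc + C\<beta> + C\<xi>"] exI[of _ "\<kappa>' / 8"]) auto
qed

theorem theorem4p2:
  fixes \<Omega> :: "(real^'n::finite) set"
    and \<mu> lam \<kappa> \<gamma> R :: real
    and \<rho>0 e0 :: "real^'n \<Rightarrow> real"
    and u0 :: "real^'n \<Rightarrow> real^'n"
  assumes "bounded \<Omega>" and "open \<Omega>" and "smooth_boundary \<Omega>"
    and "\<mu> > 0" and "2 * \<mu> + real CARD('n) * lam \<ge> 0"
    and "\<kappa> > 0" and "\<gamma> > 1" and "R > 0"
    and "continuous_on (closure \<Omega>) \<rho>0"
    and "\<forall>x\<in>\<Omega>. \<rho>0 x > 0" and "\<forall>x\<in>frontier \<Omega>. \<rho>0 x = 0"
    and "continuous_on (closure \<Omega>) u0" and "continuous_on (closure \<Omega>) e0"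
    and "\<forall>x\<in>\<Omega>. e0 x \<ge> 0" and "\<exists>x\<in>\<Omega>. e0 x \<noteq> 0"
  shows "\<forall>T>0. \<not> (\<exists>v e \<eta>. is_solution \<Omega> \<mu> lam \<kappa> \<gamma> R T \<rho>0 u0 e0 v e \<eta>)"
proof (intro allI impI notI)
  fix T :: real
  assume T: "T > 0" and "\<exists>v e \<eta>. is_solution \<Omega> \<mu> lam \<kappa> \<gamma> R T \<rho>0 u0 e0 v e \<eta>"
  then obtain v e \<eta> where sol: "is_solution \<Omega> \<mu> lam \<kappa> \<gamma> R T \<rho>0 u0 e0 v e \<eta>" by blast
  have reg: "C21 \<Omega> T e" and init: "\<And>x. x \<in> \<Omega> \<Longrightarrow> e x 0 = e0 x"
    and bdry: "\<And>x t. x \<in> frontier \<Omega> \<Longrightarrow> t \<in> {0<..T} \<Longrightarrow> e x t = 0"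
    and grad: "\<And>x t i. x \<in> frontier \<Omega> \<Longrightarrow> t \<in> {0<..T} \<Longrightarrow>
        ((\<lambda>(y, s). pdx i e y s) \<longlongrightarrow> 0) (at (x, t) within \<Omega> \<times> {0..T})"
    using sol unfolding is_solution_def by blast+
  have "\<exists>\<tau> C \<theta>. 0 < \<tau> \<and> \<tau> \<le> T \<and> 0 \<le> C \<and> 0 < \<theta> \<and> supersolution \<Omega> T \<tau> \<rho>0 C \<theta> e"
    by (rule energy_supersolution[of \<Omega> T \<mu> lam \<kappa> \<gamma> R v e \<eta>])
       (use assms T sol in \<open>unfold is_solution_def, blast+\<close>)
  then obtain \<tau> C \<theta> where \<tau>: "0 < \<tau>" "\<tau> \<le> T" "0 \<le> C" "0 < \<theta>" and super: "supersolution \<Omega> T \<tau> \<rho>0 C \<theta> e"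
    by blast
  obtain x0 where x0: "x0 \<in> \<Omega>" "e0 x0 \<noteq> 0" using assms(15) by blast
  show False
  proof (rule no_supersolution[OF assms(1,2) \<tau>(1,2) reg super \<tau>(3,4) _ assms(9) _ x0(1)])
    show "e x0 0 > 0" using x0 assms(14) init[OF x0(1)] by (auto simp: less_le)
  qed (use assms init bdry grad \<tau> in auto)
qed

end
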